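(* Let $(R,\mathfrak{m},K)$ be either a standard graded $K$-algebra or a Noetherian local ring, of prime characteristic $p$. Assume further that $R$ is $F$-finite and $F$-pure. If $\mathfrak{a}$ is a proper ideal of $R$, homogeneous in case $R$ is graded, then $$\mathrm{fpt}(\mathfrak{a})=\lim_{e\to\infty}\frac{c^{I_e}(\mathfrak{a})}{p^e}.$$
   Context: Convention: $0\in\mathbb{N}$. A standard graded $K$-algebra is an $\mathbb{N}$-graded algebra $R$ with $R_0=K$ a field, generated over $K$ by finitely many elements of degree one; $\mathfrak{m}$ is its irrelevant maximal ideal. In the local case $\mathfrak{m}$ is the maximal ideal and $K=R/\mathfrak{m}$. For $e\in\mathbb{N}$, $F^e_*R$ denotes $R$ viewed as an $R$-module via the $e$-th iterated Frobenius $F^e:R\to R$, $r\mapsto r^{p^e}$. $R$ is $F$-finite if $F_*R$ is a finitely generated $R$-module; $R$ is $F$-pure if the Frobenius $F:R\to R$ is a pure morphism. For an ideal $J$, $J^{[p^e]}$ is the ideal generated by the $p^e$-th powers of the elements of $J$. For ideals $\mathfrak{a},J$ with $J$ proper and $\mathfrak{a}\subseteq\sqrt{J}$: $\nu^J_{\mathfrak{a}}(p^e)=\max\{t\in\mathbb{N}\mid \mathfrak{a}^t\not\subseteq J^{[p^e]}\}$ and the $F$-threshold is $c^J(\mathfrak{a})=\lim_{e\to\infty}\nu^J_{\mathfrak{a}}(p^e)/p^e$ (the limit exists). For $e\in\mathbb{N}$ let $I_e=\{f\in R\mid \psi(F^e_*f)\in\mathfrak{m}\text{ for all } R\text{-linear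 maps }\psi:F^e_*R\to R\}$ (an ideal; $I_0=\mathfrak{m}$). For a proper ideal $\mathfrak{a}$ (homogeneous in the graded case), the $F$-pure threshold is $\mathrm{fpt}(\mathfrak{a})=\lim_{e\to\infty}b_{\mathfrak{a}}(p^e)/p^e$, where $b_{\mathfrak{a}}(p^e)=\max\{t\in\mathbb{N}\mid \mathfrak{a}^t\not\subseteq I_e\}$. *)

theory Defs
  imports Complex_Main "HOL-Computational_Algebra.Primes" "HOL-Algebra.Algebra"
begin

text \<open>The order of an element of infinite order is 0, so this is 0 in characteristic zero.\<close>

definition ring_char :: "('a, 'b) ring_scheme \<Rightarrow> nat" where
  "ring_char R = group.ord (add_monoid R) \<one>\<^bsub>R\<^esub>"


section \<open>The two kinds of rings\<close>

locale noetherian_local_ring = cring R + noetherian_ring R for R (structure) +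
  fixes \<mm> :: "'a set"
  assumes maximal: "maximalideal \<mm> R"
    and unique_maximal: "maximalideal M R \<Longrightarrow> M = \<mm>"

text \<open>The base field is \<open>G 0\<close>; \<open>decomposition\<close> says that \<open>R\<close> is the internal direct sum of
  the \<open>G n\<close>.\<close>

locale standard_graded_algebra = cring R for R (structure) +
  fixes G :: "nat \<Rightarrow> 'a set"
  assumes component_subgroup: "additive_subgroup (G n) R"
    and component_mult: "\<lbrakk> x \<in> G i; y \<in> G j \<rbrakk> \<Longrightarrow> x \<otimes> y \<in> G (i + j)"
    and decomposition: "x \<in> carrier R \<Longrightarrow>
      \<exists>!f. (\<forall>n. f n \<in> G n) \<and> finite {n. f n \<noteq> \<zero>} \<and> x = (\<Oplus>n\<in>{n. f n \<noteq> \<zero>}. f n)"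
    and base_field: "subfield (G 0) R"
    and generated_in_degree_one:
      "\<exists>S. finite S \<and> S \<subseteq> G 1 \<and> carrier R = generate_ring R (G 0 \<union> S)"

definition irrelevant_ideal :: "('a, 'b) ring_scheme \<Rightarrow> (nat \<Rightarrow> 'a set) \<Rightarrow> 'a set" where
  "irrelevant_ideal R G = {\<Oplus>\<^bsub>R\<^esub>n\<in>{1..N}. f n | f N. \<forall>n. f n \<in> G n}"

definition homogeneous_ideal :: "('a, 'b) ring_scheme \<Rightarrow> (nat \<Rightarrow> 'a set) \<Rightarrow> 'a set \<Rightarrow> bool" where
  "homogeneous_ideal R G I \<longleftrightarrow> ideal I R \<and> I = Idl\<^bsub>R\<^esub> (I \<inter> (\<Union>n. G n))"


section \<open>Modules\<close>

text \<open>A ring \<open>S\<close> as a module over the source of a ring homomorphism \<open>h\<close> into \<open>S\<close>.\<close>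

definition restrict_scalars :: "('b, 'm) ring_scheme \<Rightarrow> ('a \<Rightarrow> 'b) \<Rightarrow> ('a, 'b) module" where
  "restrict_scalars S h =
     \<lparr>carrier = carrier S, monoid.mult = monoid.mult S, one = one S, ring.zero = ring.zero S, ring.add = ring.add S,
      smult = (\<lambda>r s. h r \<otimes>\<^bsub>S\<^esub> s)\<rparr>"

definition regular_module :: "('a, 'm) ring_scheme \<Rightarrow> ('a, 'a) module" where
  "regular_module R = restrict_scalars R (\<lambda>r. r)"

text \<open>\<open>F\<^sup>e\<^sub>* R\<close>, with the same underlying set as \<open>R\<close>.\<close>

definition frobenius_module :: "('a, 'm) ring_scheme \<Rightarrow> nat \<Rightarrow> nat \<Rightarrow> ('a, 'a) module" where
  "frobenius_module R p e = restrict_scalars R (\<lambda>r. r [^]\<^bsub>R\<^esub> (p ^ e))"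

definition linear_maps ::
    "('a, 'm) ring_scheme \<Rightarrow> ('a, 'b) module \<Rightarrow> ('a, 'c) module \<Rightarrow> ('b \<Rightarrow> 'c) set" where
  "linear_maps R M N =
     {\<psi> \<in> carrier M \<rightarrow> carrier N.
        (\<forall>x\<in>carrier M. \<forall>y\<in>carrier M. \<psi> (x \<oplus>\<^bsub>M\<^esub> y) = \<psi> x \<oplus>\<^bsub>N\<^esub> \<psi> y) \<and>
        (\<forall>r\<in>carrier R. \<forall>x\<in>carrier M. \<psi> (r \<odot>\<^bsub>M\<^esub> x) = r \<odot>\<^bsub>N\<^esub> \<psi> x)}"

definition finitely_generated_module :: "('a, 'm) ring_scheme \<Rightarrow> ('a, 'b) module \<Rightarrow> bool" where
  "finitely_generated_module R M \<longleftrightarrow>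
     (\<exists>B. finite B \<and> B \<subseteq> carrier M \<and>
        (\<forall>x\<in>carrier M. \<exists>c\<in>B \<rightarrow> carrier R. x = (\<Oplus>\<^bsub>M\<^esub>b\<in>B. c b \<odot>\<^bsub>M\<^esub> b)))"

text \<open>The tensor product \<open>M \<otimes>\<^sub>R N\<close> is the free abelian group on \<open>carrier M \<times> carrier N\<close>
  modulo the subgroup below. Only its additive structure is needed, to express injectivity.\<close>

definition tensor_relations ::
    "('a, 'm) ring_scheme \<Rightarrow> ('a, 'b) module \<Rightarrow> ('a, 'c) module \<Rightarrow> ('b \<times> 'c \<Rightarrow>\<^sub>0 int) set" where
  "tensor_relations R M N = generate (free_Abelian_group (carrier M \<times> carrier N))
     ({frag_of (x \<oplus>\<^bsub>M\<^esub> x', y) - frag_of (x, y) - frag_of (x', y) | x x' y.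
         x \<in> carrier M \<and> x' \<in> carrier M \<and> y \<in> carrier N} \<union>
      {frag_of (x, y \<oplus>\<^bsub>N\<^esub> y') - frag_of (x, y) - frag_of (x, y') | x y y'.
         x \<in> carrier M \<and> y \<in> carrier N \<and> y' \<in> carrier N} \<union>
      {frag_of (r \<odot>\<^bsub>M\<^esub> x, y) - frag_of (x, r \<odot>\<^bsub>N\<^esub> y) | r x y.
         r \<in> carrier R \<and> x \<in> carrier M \<and> y \<in> carrier N})"

definition pure_tensor ::
    "('a, 'm) ring_scheme \<Rightarrow> ('a, 'b) module \<Rightarrow> ('a, 'c) module \<Rightarrow> 'b \<Rightarrow> 'c \<Rightarrow>
      ('b \<times> 'c \<Rightarrow>\<^sub>0 int) set" where
  "pure_tensor R M N x y =
     tensor_relations R M N #>\<^bsub>free_Abelian_group (carrier M \<times> carrier N)\<^esub> frag_of (x, y)"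

text \<open>\<open>h : R \<rightarrow> S\<close> is pure if \<open>M \<rightarrow> M \<otimes>\<^sub>R S\<close>, \<open>x \<mapsto> x \<otimes> 1\<close> is injective for every
  \<open>R\<close>-module \<open>M\<close>. A quantifier inside a definition needs a fixed type for the elements of
  \<open>M\<close>. The type \<open>(nat \<Rightarrow> 'a) set\<close> is large enough: finitely generated modules suffice to test
  purity (an element dying in \<open>M \<otimes>\<^sub>R S\<close> already dies in \<open>M' \<otimes>\<^sub>R S\<close> for some finitely generated
  submodule \<open>M'\<close> of \<open>M\<close> containing it), and each of them is isomorphic to a quotient of some \<open>R\<^sup>n\<close>,
  whose elements are sets of finitely supported sequences in \<open>R\<close>.\<close>

definition pure_morphism ::
    "('a, 'm) ring_scheme \<Rightarrow> ('b, 'n) ring_scheme \<Rightarrow> ('a \<Rightarrow> 'b) \<Rightarrow> bool" where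
  "pure_morphism R S h \<longleftrightarrow> h \<in> ring_hom R S \<and>
     (\<forall>M :: ('a, (nat \<Rightarrow> 'a) set) module. module R M \<longrightarrow>
        inj_on (\<lambda>x. pure_tensor R M (restrict_scalars S h) x \<one>\<^bsub>S\<^esub>) (carrier M))"


section \<open>F-singularities\<close>

definition F_finite :: "('a, 'm) ring_scheme \<Rightarrow> nat \<Rightarrow> bool" where
  "F_finite R p \<longleftrightarrow> finitely_generated_module R (frobenius_module R p 1)"

definition F_pure :: "('a, 'm) ring_scheme \<Rightarrow> nat \<Rightarrow> bool" where
  "F_pure R p \<longleftrightarrow> pure_morphism R R (\<lambda>r. r [^]\<^bsub>R\<^esub> p)"

text \<open>\<open>J\<^bsup>[p\<^sup>e]\<^esup>\<close>\<close>

definition frobenius_power :: "('a, 'm) ring_scheme \<Rightarrow> nat \<Rightarrow> 'a set \<Rightarrow> nat \<Rightarrow> 'a set" where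
  "frobenius_power R p J e = Idl\<^bsub>R\<^esub> ((\<lambda>x. x [^]\<^bsub>R\<^esub> (p ^ e)) ` J)"

text \<open>Powers of ideals are taken in the multiplicative monoid \<open>ideals_set R\<close> of all ideals, whose
  unit is \<open>carrier R\<close>. The maxima and limits below are meaningful for proper \<open>J\<close> with
  \<open>\<aa> \<subseteq> \<surd>J\<close>.\<close>

definition F_threshold_nu ::
    "('a, 'm) ring_scheme \<Rightarrow> nat \<Rightarrow> 'a set \<Rightarrow> 'a set \<Rightarrow> nat \<Rightarrow> nat" where
  "F_threshold_nu R p J \<aa> e = Max {t. \<not> \<aa> [^]\<^bsub>ideals_set R\<^esub> t \<subseteq> frobenius_power R p J e}"

definition F_threshold :: "('a, 'm) ring_scheme \<Rightarrow> nat \<Rightarrow> 'a set \<Rightarrow> 'a set \<Rightarrow> real" where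
  "F_threshold R p J \<aa> = lim (\<lambda>e. real (F_threshold_nu R p J \<aa> e) / real (p ^ e))"

text \<open>The ideals \<open>I\<^sub>e\<close>.\<close>

definition splitting_ideal :: "('a, 'm) ring_scheme \<Rightarrow> 'a set \<Rightarrow> nat \<Rightarrow> nat \<Rightarrow> 'a set" where
  "splitting_ideal R \<mm> p e =
     {f \<in> carrier R. \<forall>\<psi>\<in>linear_maps R (frobenius_module R p e) (regular_module R). \<psi> f \<in> \<mm>}"

definition fpt_b :: "('a, 'm) ring_scheme \<Rightarrow> 'a set \<Rightarrow> nat \<Rightarrow> 'a set \<Rightarrow> nat \<Rightarrow> nat" where
  "fpt_b R \<mm> p \<aa> e = Max {t. \<not> \<aa> [^]\<^bsub>ideals_set R\<^esub> t \<subseteq> splitting_ideal R \<mm> p e}"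

definition fpt :: "('a, 'm) ring_scheme \<Rightarrow> 'a set \<Rightarrow> nat \<Rightarrow> 'a set \<Rightarrow> real" where
  "fpt R \<mm> p \<aa> = lim (\<lambda>e. real (fpt_b R \<mm> p \<aa> e) / real (p ^ e))"

end

(* Let B be a finite generating set of a and q = p^k. By pigeonhole on exponents of monomials in B,
   a^s is contained in (a^t)^[q] as soon as s >= q (t + card B). Hence, for a proper ideal J with a
   contained in its radical, nu(e + 1) <= p (nu(e) + card B + 1), so that nu(e) / p^e is decreasing up
   to an error O(1 / p^e); it converges, and its limit is at most nu(0) + 2 (card B + 1).
   Precomposing linear maps with Frobenius shows that I_e^[p^k] is contained in I_(e+k), whence
   b(e + k) <= nu^(I_e)(p^k). The case k = 1 gives the convergence of b(e) / p^e, and letting k grow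

     fpt(a) <= c^(I_e)(a) / p^e <= b(e) / p^e + 2 (card B + 1) / p^e,

   where the right-hand side tends to fpt(a). *)

theory Submission
  imports Defs
begin

section \<open>Finitely generated algebras over a field are Noetherian\<close>

text \<open>The pigeonhole step needs finitely many generators of the ideal a, so R has to be
  Noetherian. In the graded case this is Hilbert's basis theorem, proved inside R itself: generators
  are adjoined to the field \<open>G 0\<close> one at a time. A new element may satisfy relations
  over the previous subring, so degrees and leading coefficients belong to presentations of an
  element and not to the element. The maxima are finite because a \<subseteq> m, which holds in the
  two settings for different reasons, and m^[p^e] \<subseteq> I_e. The constant card B + 1 is the
  pigeonhole loss card B plus one for passing from the largest exponent outside J^[p^e] to the
  smallest one inside. Iterating u(e+1) \<le> p (u(e) + C) accumulates the geometric series C (1 +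
  1/p + ...) = C p / (p - 1) \<le> 2 C, whence the factor 2.\<close>

context cring
begin

lemma ideal_cringI:
  assumes "I \<subseteq> carrier R" "\<zero> \<in> I" "\<And>x y. x \<in> I \<Longrightarrow> y \<in> I \<Longrightarrow> x \<oplus> y \<in> I"
    and mult: "\<And>r x. r \<in> carrier R \<Longrightarrow> x \<in> I \<Longrightarrow> r \<otimes> x \<in> I"
  shows "ideal I R"
proof (rule idealI)
  have "\<ominus> x \<in> I" if "x \<in> I" for x
    using mult[of "\<ominus> \<one>" x] that assms(1) by (auto simp: l_minus subset_iff)
  then show "subgroup I (add_monoid R)"
    using assms by unfold_locales (auto simp flip: a_inv_def)
  show "x \<otimes> r \<in> I" if "x \<in> I" "r \<in> carrier R" for x r
    using mult[OF that(2,1)] that assms(1) m_comm by auto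
qed (use mult ring_axioms in auto)

lemma subring_ideal_iff:
  assumes "subring A R"
  shows "ideal I (R\<lparr>carrier := A\<rparr>) \<longleftrightarrow> I \<subseteq> A \<and> \<zero> \<in> I \<and>
    (\<forall>x\<in>I. \<forall>y\<in>I. x \<oplus> y \<in> I) \<and> (\<forall>r\<in>A. \<forall>x\<in>I. r \<otimes> x \<in> I)"
proof -
  interpret A: cring "R\<lparr>carrier := A\<rparr>"
    using subcringI'[OF assms] unfolding subcring_iff[OF subringE(1)[OF assms]] .
  show ?thesis
  proof
    assume "ideal I (R\<lparr>carrier := A\<rparr>)"
    then interpret I: ideal I "R\<lparr>carrier := A\<rparr>" .
    show "I \<subseteq> A \<and> \<zero> \<in> I \<and> (\<forall>x\<in>I. \<forall>y\<in>I. x \<oplus> y \<in> I) \<and> (\<forall>r\<in>A. \<forall>x\<in>I. r \<otimes> x \<in> I)"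
      using I.a_subset I.zero_closed I.a_closed I.I_l_closed by simp
  qed (auto intro!: A.ideal_cringI)
qed

text \<open>Values at \<open>x\<close> of the polynomials of degree less than \<open>n\<close> with coefficients in \<open>A\<close>.\<close>

primrec poly_vals :: "'a set \<Rightarrow> 'a \<Rightarrow> nat \<Rightarrow> 'a set" where
  "poly_vals A x 0 = {\<zero>}"
| "poly_vals A x (Suc n) = {a \<otimes> x [^] n \<oplus> y | a y. a \<in> A \<and> y \<in> poly_vals A x n}"

lemma poly_vals_SucI:
  "a \<in> A \<Longrightarrow> y \<in> poly_vals A x n \<Longrightarrow> a \<otimes> x [^] n \<oplus> y \<in> poly_vals A x (Suc n)"
  by auto

definition adjoin :: "'a set \<Rightarrow> 'a \<Rightarrow> 'a set" where
  "adjoin A x = (\<Union>n. poly_vals A x n)"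

text \<open>The ideals of leading coefficients from Hilbert's basis theorem. A coefficient counts as
  soon as one presentation of an element of I has it in degree n; zero is allowed, so that an ideal
  results.\<close>

definition leading_coeffs :: "'a set \<Rightarrow> 'a \<Rightarrow> 'a set \<Rightarrow> nat \<Rightarrow> 'a set" where
  "leading_coeffs A x I n = {c \<in> A. \<exists>y\<in>poly_vals A x n. c \<otimes> x [^] n \<oplus> y \<in> I}"

context
  fixes A x
  assumes A: "subring A R" and x: "x \<in> carrier R"
begin

lemma coeff_carrier: "a \<in> A \<Longrightarrow> a \<in> carrier R"
  using subringE(1)[OF A] by blast

lemma poly_vals_carrier: "y \<in> poly_vals A x n \<Longrightarrow> y \<in> carrier R"
  by (induction n arbitrary: y) (auto simp: coeff_carrier x)

lemma poly_vals_zero: "\<zero> \<in> poly_vals A x n"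
proof (induction n)
  case (Suc n)
  have "\<zero> \<otimes> x [^] n \<oplus> \<zero> = \<zero>" using x by simp
  then show ?case using poly_vals_SucI[OF subringE(2)[OF A] Suc] by simp
qed simp

lemma poly_vals_Suc: "y \<in> poly_vals A x n \<Longrightarrow> y \<in> poly_vals A x (Suc n)"
  using poly_vals_SucI[OF subringE(2)[OF A], of y x n] poly_vals_carrier[of y n] x
  by (simp del: poly_vals.simps)

lemma poly_vals_mono: "y \<in> poly_vals A x n \<Longrightarrow> n \<le> m \<Longrightarrow> y \<in> poly_vals A x m"
  by (rotate_tac 1, induction rule: dec_induct) (auto simp del: poly_vals.simps intro: poly_vals_Suc)

lemma poly_vals_add:
  "y \<in> poly_vals A x n \<Longrightarrow> z \<in> poly_vals A x n \<Longrightarrow> y \<oplus> z \<in> poly_vals A x n"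
proof (induction n arbitrary: y z)
  case (Suc n)
  then obtain a b y' z' where *: "a \<in> A" "b \<in> A" "y' \<in> poly_vals A x n" "z' \<in> poly_vals A x n"
    "y = a \<otimes> x [^] n \<oplus> y'" "z = b \<otimes> x [^] n \<oplus> z'" by auto
  have "y \<oplus> z = (a \<oplus> b) \<otimes> x [^] n \<oplus> (y' \<oplus> z')"
    using * x coeff_carrier poly_vals_carrier by (simp add: l_distr a_ac)
  then show ?case using * poly_vals_SucI[OF _ Suc.IH] subringE(7)[OF A] by metis
qed simp

lemma poly_vals_smult:
  "a \<in> A \<Longrightarrow> y \<in> poly_vals A x n \<Longrightarrow> a \<otimes> y \<in> poly_vals A x n"
proof (induction n arbitrary: y)
  case 0
  then show ?case using coeff_carrier by simp
next
  case (Suc n)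
  then obtain b y' where *: "b \<in> A" "y' \<in> poly_vals A x n" "y = b \<otimes> x [^] n \<oplus> y'" by auto
  have "a \<otimes> y = (a \<otimes> b) \<otimes> x [^] n \<oplus> a \<otimes> y'"
    using * Suc.prems x coeff_carrier poly_vals_carrier by (simp add: r_distr m_assoc)
  then show ?case using * poly_vals_SucI[OF _ Suc.IH] Suc.prems(1) subringE(6)[OF A] by metis
qed

lemma poly_vals_shift: "y \<in> poly_vals A x n \<Longrightarrow> x \<otimes> y \<in> poly_vals A x (Suc n)"
proof (induction n arbitrary: y)
  case 0
  then show ?case using x poly_vals_zero[of "Suc 0"] by (simp del: poly_vals.simps(2))
next
  case (Suc n)
  then obtain b y' where *: "b \<in> A" "y' \<in> poly_vals A x n" "y = b \<otimes> x [^] n \<oplus> y'" by auto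
  have "x \<otimes> y = b \<otimes> x [^] Suc n \<oplus> x \<otimes> y'"
    using * x coeff_carrier poly_vals_carrier by (simp add: r_distr m_ac)
  then show ?case using poly_vals_SucI[OF *(1) Suc.IH[OF *(2)]] by simp
qed

lemma poly_vals_power_shift: "y \<in> poly_vals A x n \<Longrightarrow> x [^] k \<otimes> y \<in> poly_vals A x (k + n)"
proof (induction k)
  case 0
  then show ?case using poly_vals_carrier by simp
next
  case (Suc k)
  have "x \<otimes> (x [^] k \<otimes> y) = x [^] Suc k \<otimes> y"
    using x poly_vals_carrier[OF Suc.prems] by (simp add: m_ac)
  then show ?case
    using poly_vals_shift[OF Suc.IH[OF Suc.prems]] by (simp del: poly_vals.simps nat_pow_Suc)
qed

lemma poly_vals_mult:
  "y \<in> poly_vals A x n \<Longrightarrow> z \<in> poly_vals A x m \<Longrightarrow> y \<otimes> z \<in> poly_vals A x (n + m)"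
proof (induction n arbitrary: y)
  case 0
  then show ?case using poly_vals_carrier poly_vals_zero by simp
next
  case (Suc n)
  then obtain b y' where *: "b \<in> A" "y' \<in> poly_vals A x n" "y = b \<otimes> x [^] n \<oplus> y'" by auto
  have "y \<otimes> z = b \<otimes> (x [^] n \<otimes> z) \<oplus> y' \<otimes> z"
    using * x coeff_carrier poly_vals_carrier Suc.prems(2) by (simp add: l_distr m_assoc)
  also have "\<dots> \<in> poly_vals A x (n + m)"
    by (rule poly_vals_add[OF poly_vals_smult[OF *(1) poly_vals_power_shift[OF Suc.prems(2)]]
          Suc.IH[OF *(2) Suc.prems(2)]])
  finally show ?case using poly_vals_Suc by (simp del: poly_vals.simps)
qed

lemma poly_vals_of_coeff: "a \<in> A \<Longrightarrow> a \<in> poly_vals A x 1"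
  using poly_vals_SucI[of a A \<zero> x 0] coeff_carrier[of a] x by simp

lemma adjoin_carrier: "adjoin A x \<subseteq> carrier R"
  using poly_vals_carrier by (auto simp: adjoin_def)

lemma subset_adjoin: "A \<subseteq> adjoin A x"
  using poly_vals_of_coeff unfolding adjoin_def by blast

lemma mem_adjoin: "x \<in> adjoin A x"
proof -
  have "x \<otimes> \<one> \<in> poly_vals A x (Suc 1)"
    using poly_vals_shift[OF poly_vals_of_coeff[OF subringE(3)[OF A]]] .
  then show ?thesis using x unfolding adjoin_def by (metis UN_I UNIV_I r_one)
qed

lemma adjoin_subring: "subring (adjoin A x) R"
proof (rule subringI)
  show "adjoin A x \<subseteq> carrier R" by (rule adjoin_carrier)
  show "\<one> \<in> adjoin A x" using subset_adjoin subringE(3)[OF A] by blast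
  show mult: "y \<otimes> z \<in> adjoin A x" if "y \<in> adjoin A x" "z \<in> adjoin A x" for y z
    using that poly_vals_mult unfolding adjoin_def by blast
  show "y \<oplus> z \<in> adjoin A x" if yz: "y \<in> adjoin A x" "z \<in> adjoin A x" for y z
  proof -
    obtain n m where "y \<in> poly_vals A x n" "z \<in> poly_vals A x m"
      using yz unfolding adjoin_def by blast
    then have "y \<oplus> z \<in> poly_vals A x (max n m)"
      using poly_vals_mono[of _ _ "max n m"] by (intro poly_vals_add) auto
    then show ?thesis unfolding adjoin_def by blast
  qed
  show "\<ominus> y \<in> adjoin A x" if y: "y \<in> adjoin A x" for y
  proof -
    have "\<ominus> \<one> \<otimes> y \<in> adjoin A x"
      using y subset_adjoin subringE(3,5)[OF A] by (intro mult) auto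
    then show ?thesis using y adjoin_carrier by (auto simp: l_minus)
  qed
qed

lemma adjoin_subset:
  assumes S: "subring S R" and "A \<subseteq> S" "x \<in> S"
  shows "adjoin A x \<subseteq> S"
proof -
  have pow: "x [^] n \<in> S" for n :: nat
    by (induction n) (auto simp: subringE(3,6)[OF S] assms(3))
  have "poly_vals A x n \<subseteq> S" for n
    by (induction n) (use pow assms subringE(2,6,7)[OF S] in \<open>auto simp: subset_iff\<close>)
  then show ?thesis unfolding adjoin_def by blast
qed

lemma leading_coeffs_ideal:
  assumes "ideal I (R\<lparr>carrier := adjoin A x\<rparr>)"
  shows "ideal (leading_coeffs A x I n) (R\<lparr>carrier := A\<rparr>)"
proof -
  note I = assms[unfolded subring_ideal_iff[OF adjoin_subring]]
  show ?thesis unfolding subring_ideal_iff[OF A]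
  proof (intro conjI ballI)
    show "leading_coeffs A x I n \<subseteq> A" by (auto simp: leading_coeffs_def)
    have "\<zero> \<otimes> x [^] n \<oplus> \<zero> \<in> I" using I x by simp
    then show "\<zero> \<in> leading_coeffs A x I n"
      using subringE(2)[OF A] poly_vals_zero unfolding leading_coeffs_def by blast
  next
    fix a b assume "a \<in> leading_coeffs A x I n" "b \<in> leading_coeffs A x I n"
    then obtain y z where *: "a \<in> A" "b \<in> A" "y \<in> poly_vals A x n" "z \<in> poly_vals A x n"
      "a \<otimes> x [^] n \<oplus> y \<in> I" "b \<otimes> x [^] n \<oplus> z \<in> I" unfolding leading_coeffs_def by blast
    have "(a \<oplus> b) \<otimes> x [^] n \<oplus> (y \<oplus> z) = (a \<otimes> x [^] n \<oplus> y) \<oplus> (b \<otimes> x [^] n \<oplus> z)"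
      using * x coeff_carrier poly_vals_carrier by (simp add: l_distr a_ac)
    also have "\<dots> \<in> I" using * I by blast
    finally show "a \<oplus> b \<in> leading_coeffs A x I n"
      using * subringE(7)[OF A] poly_vals_add unfolding leading_coeffs_def by blast
  next
    fix r a assume "r \<in> A" "a \<in> leading_coeffs A x I n"
    then obtain y where *: "r \<in> A" "a \<in> A" "y \<in> poly_vals A x n" "a \<otimes> x [^] n \<oplus> y \<in> I"
      unfolding leading_coeffs_def by blast
    have "(r \<otimes> a) \<otimes> x [^] n \<oplus> (r \<otimes> y) = r \<otimes> (a \<otimes> x [^] n \<oplus> y)"
      using * x coeff_carrier poly_vals_carrier by (simp add: r_distr m_assoc)
    also have "\<dots> \<in> I" using * I subset_adjoin by blast
    finally show "r \<otimes> a \<in> leading_coeffs A x I n"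
      using * subringE(6)[OF A] poly_vals_smult unfolding leading_coeffs_def by blast
  qed
qed

text \<open>Multiplication by x stays in I, raises the degree of a presentation by one and keeps its
  leading coefficient.\<close>

lemma leading_coeffs_mono:
  assumes "ideal I (R\<lparr>carrier := adjoin A x\<rparr>)" and "n \<le> m"
  shows "leading_coeffs A x I n \<subseteq> leading_coeffs A x I m"
  using \<open>n \<le> m\<close>
proof (rule lift_Suc_mono_le[rotated])
  note I = assms(1)[unfolded subring_ideal_iff[OF adjoin_subring]]
  show "leading_coeffs A x I k \<subseteq> leading_coeffs A x I (Suc k)" for k
  proof
    fix a assume "a \<in> leading_coeffs A x I k"
    then obtain y where *: "a \<in> A" "y \<in> poly_vals A x k" "a \<otimes> x [^] k \<oplus> y \<in> I"
      unfolding leading_coeffs_def by blast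
    have "a \<otimes> x [^] Suc k \<oplus> x \<otimes> y = x \<otimes> (a \<otimes> x [^] k \<oplus> y)"
      using * x coeff_carrier poly_vals_carrier by (simp add: r_distr m_ac)
    also have "\<dots> \<in> I" using *(3) mem_adjoin I by blast
    finally show "a \<in> leading_coeffs A x I (Suc k)"
      using *(1) poly_vals_shift[OF *(2)] unfolding leading_coeffs_def by blast
  qed
qed

text \<open>Induction on the degree bound: an element of I and an element of J with the same leading
  coefficient differ by something of lower degree. As J \<subseteq> I, the difference is again in I,
  hence in J by induction.\<close>

lemma ideal_subset_if_leading_coeffs_subset:
  assumes "ideal I (R\<lparr>carrier := adjoin A x\<rparr>)" "ideal J (R\<lparr>carrier := adjoin A x\<rparr>)"
    and "J \<subseteq> I" and lead: "\<And>n. leading_coeffs A x I n \<subseteq> leading_coeffs A x J n"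
  shows "I \<subseteq> J"
proof -
  note I = assms(1)[unfolded subring_ideal_iff[OF adjoin_subring]]
  note J = assms(2)[unfolded subring_ideal_iff[OF adjoin_subring]]
  have m1: "\<ominus> \<one> \<in> A" using subringE(3,5)[OF A] by blast
  have "y \<in> I \<Longrightarrow> y \<in> poly_vals A x n \<Longrightarrow> y \<in> J" for y n
  proof (induction n arbitrary: y)
    case 0
    then show ?case using J by simp
  next
    case (Suc n)
    then obtain c z where c: "c \<in> A" "z \<in> poly_vals A x n" "y = c \<otimes> x [^] n \<oplus> z" by auto
    then have "c \<in> leading_coeffs A x I n"
      using Suc.prems(1) unfolding leading_coeffs_def by blast
    then obtain z' where z': "z' \<in> poly_vals A x n" "c \<otimes> x [^] n \<oplus> z' \<in> J"
      using lead unfolding leading_coeffs_def by blast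
    let ?w = "c \<otimes> x [^] n \<oplus> z'"
    have car: "c \<in> carrier R" "z \<in> carrier R" "z' \<in> carrier R"
      using c z' coeff_carrier poly_vals_carrier by blast+
    have "\<ominus> \<one> \<otimes> ?w \<in> I"
      using z'(2) \<open>J \<subseteq> I\<close> I m1 subset_adjoin by blast
    then have "y \<oplus> \<ominus> \<one> \<otimes> ?w \<in> I" using Suc.prems(1) I by blast
    also have "y \<oplus> \<ominus> \<one> \<otimes> ?w = z \<oplus> \<ominus> \<one> \<otimes> z'"
    proof -
      have "y \<oplus> \<ominus> \<one> \<otimes> ?w = (c \<otimes> x [^] n \<oplus> \<ominus> (c \<otimes> x [^] n)) \<oplus> (z \<oplus> \<ominus> z')"
        using car x by (simp add: c(3) l_minus minus_add a_ac)
      then show ?thesis using car x by (simp add: r_neg l_minus)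
    qed
    finally have "z \<oplus> \<ominus> \<one> \<otimes> z' \<in> J"
      using c(2) z'(1) m1 by (intro Suc.IH poly_vals_add poly_vals_smult)
    then have "?w \<oplus> (z \<oplus> \<ominus> \<one> \<otimes> z') \<in> J" using z'(2) J by blast
    also have "?w \<oplus> (z \<oplus> \<ominus> \<one> \<otimes> z') = c \<otimes> x [^] n \<oplus> z \<oplus> (z' \<oplus> \<ominus> z')"
      using car x by (simp add: l_minus a_ac)
    also have "\<dots> = y" using car x by (simp add: c(3) r_neg)
    finally show ?case .
  qed
  then show ?thesis using I unfolding adjoin_def by blast
qed

text \<open>The leading coefficient ideals of I form an ascending chain in A, stationary from some N
  on. Lifting finite generating sets of those of degree at most N yields a subset of I whose ideal
  has the same leading coefficients as I.\<close>

lemma hilbert_basis_adjoin: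
  assumes "noetherian_ring (R\<lparr>carrier := A\<rparr>)"
  shows "noetherian_ring (R\<lparr>carrier := adjoin A x\<rparr>)"
proof -
  let ?T = "R\<lparr>carrier := adjoin A x\<rparr>" and ?L = "leading_coeffs A x"
  interpret A: noetherian_ring "R\<lparr>carrier := A\<rparr>" by fact
  interpret T: ring ?T using subring_is_ring[OF adjoin_subring] .
  show ?thesis
  proof (rule T.noetherian_ringI)
    fix I assume I: "ideal I ?T"
    have I_sub: "I \<subseteq> adjoin A x"
      using I unfolding subring_ideal_iff[OF adjoin_subring] by blast
    have "subset.chain {I. ideal I (R\<lparr>carrier := A\<rparr>)} (range (?L I))"
      unfolding subset_chain_def
    proof (intro conjI ballI)
      show "range (?L I) \<subseteq> {I. ideal I (R\<lparr>carrier := A\<rparr>)}"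
        using leading_coeffs_ideal[OF I] by (rule image_subsetI[OF CollectI])
      fix U V assume "U \<in> range (?L I)" "V \<in> range (?L I)"
      then obtain n m where "U = ?L I n" "V = ?L I m" by blast
      then show "U \<subseteq> V \<or> V \<subseteq> U"
        using nat_le_linear[of n m] leading_coeffs_mono[OF I, of n m] leading_coeffs_mono[OF I, of m n]
        by argo
    qed
    \<comment> \<open>Stationarity in the form that a nonempty chain of ideals contains its own
      union; the member equal to the union provides N.\<close>
    from A.ideal_chain_is_trivial[OF _ this]
    have "\<Union> (range (?L I)) \<in> range (?L I)" by simp
    then obtain N where N: "\<Union> (range (?L I)) = ?L I N" ..
    \<comment> \<open>Quantified over every ideal J containing the lifts of degree n, because J will
      be the ideal generated by the lifts of all degrees up to N.\<close>
    have "\<exists>B. finite B \<and> B \<subseteq> I \<and> (\<forall>J. ideal J ?T \<longrightarrow> B \<subseteq> J \<longrightarrow> ?L I n \<subseteq> ?L J n)" for n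
    proof -
      obtain C where C: "C \<subseteq> A" "finite C" "?L I n = Idl\<^bsub>R\<lparr>carrier := A\<rparr>\<^esub> C"
        using A.finetely_gen[OF leading_coeffs_ideal[OF I, of n]] by auto
      then have "C \<subseteq> ?L I n"
        using A.genideal_self[of C] by simp
      then have "\<forall>c\<in>C. \<exists>y. y \<in> poly_vals A x n \<and> c \<otimes> x [^] n \<oplus> y \<in> I"
        unfolding leading_coeffs_def by blast
      from bchoice[OF this]
      obtain y where y: "\<forall>c\<in>C. y c \<in> poly_vals A x n \<and> c \<otimes> x [^] n \<oplus> y c \<in> I" ..
      let ?B = "(\<lambda>c. c \<otimes> x [^] n \<oplus> y c) ` C"
      have "?L I n \<subseteq> ?L J n" if J: "ideal J ?T" and "?B \<subseteq> J" for J
      proof -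
        have "C \<subseteq> ?L J n" using y C(1) that(2) unfolding leading_coeffs_def by blast
        then show ?thesis
          unfolding C(3) by (rule A.genideal_minimal[OF leading_coeffs_ideal[OF J]])
      qed
      moreover have "finite ?B" "?B \<subseteq> I" using y C(2) by auto
      ultimately show ?thesis by (intro exI[of _ ?B]) simp
    qed
    then have "\<exists>B. \<forall>n. finite (B n) \<and> B n \<subseteq> I \<and> (\<forall>J. ideal J ?T \<longrightarrow> B n \<subseteq> J \<longrightarrow> ?L I n \<subseteq> ?L J n)"
      by (intro choice allI)
    then obtain B where B0:
      "\<forall>n. finite (B n) \<and> B n \<subseteq> I \<and> (\<forall>J. ideal J ?T \<longrightarrow> B n \<subseteq> J \<longrightarrow> ?L I n \<subseteq> ?L J n)" ..
    have B: "finite (B n)" "B n \<subseteq> I" "ideal J ?T \<Longrightarrow> B n \<subseteq> J \<Longrightarrow> ?L I n \<subseteq> ?L J n" for n J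
      using spec[OF B0, of n] by simp_all
    let ?B = "\<Union>n\<le>N. B n" and ?J = "Idl\<^bsub>?T\<^esub> (\<Union>n\<le>N. B n)"
    have B_sub: "?B \<subseteq> carrier ?T" using B(2) I_sub by auto
    have J: "ideal ?J ?T" using B_sub by (rule T.genideal_ideal)
    have "?J \<subseteq> I" using B(2) by (intro T.genideal_minimal I) auto
    have "?L I n \<subseteq> ?L ?J n" for n
    proof -
      have le: "?L I n \<subseteq> ?L ?J n" if "n \<le> N" for n
        using that T.genideal_self[OF B_sub] by (intro B(3) J) auto
      show ?thesis
      proof (cases "n \<le> N")
        case False
        \<comment> \<open>Beyond N nothing new appears for I, while the chain of \<open>?J\<close>
          still increases.\<close>
        have "?L I n \<subseteq> ?L I N" unfolding N[symmetric] by (rule UN_upper) simp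
        also have "\<dots> \<subseteq> ?L ?J N" by (rule le) simp
        also have "\<dots> \<subseteq> ?L ?J n" using False by (intro leading_coeffs_mono J) simp
        finally show ?thesis .
      qed (rule le)
    qed
    then have "I \<subseteq> ?J"
      by (rule ideal_subset_if_leading_coeffs_subset[OF I J \<open>?J \<subseteq> I\<close>])
    then have "I = ?J" using \<open>?J \<subseteq> I\<close> by (rule equalityI)
    then show "\<exists>B\<subseteq>carrier ?T. finite B \<and> I = Idl\<^bsub>?T\<^esub> B"
      using B(1) B_sub by (intro exI[of _ ?B]) simp
  qed
qed

end

lemma noetherian_generate_ring:
  assumes K: "subring K R" "noetherian_ring (R\<lparr>carrier := K\<rparr>)" and "finite S" "S \<subseteq> carrier R"
  shows "noetherian_ring (R\<lparr>carrier := generate_ring R (K \<union> S)\<rparr>)"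
  using assms(3,4)
proof (induction S)
  case empty
  have "generate_ring R K = K"
    by (rule generate_ringI[OF subringE(1)[OF K(1)] K(1) order_refl, symmetric])
  then show ?case using K(2) by simp
next
  case (insert s S)
  let ?A = "generate_ring R (K \<union> S)"
  have KS: "K \<union> S \<subseteq> carrier R" and s: "s \<in> carrier R"
    using insert.prems subringE(1)[OF K(1)] by auto
  note A = generate_ringE[OF KS refl]
  have "adjoin ?A s = generate_ring R (K \<union> insert s S)"
  proof (rule generate_ringI)
    show "K \<union> insert s S \<subseteq> carrier R" using KS s by auto
    show "subring (adjoin ?A s) R" by (rule adjoin_subring[OF A(1) s])
    show "K \<union> insert s S \<subseteq> adjoin ?A s"
      using subset_adjoin[OF A(1) s] mem_adjoin[OF A(1) s] A(2) by blast
    show "adjoin ?A s \<subseteq> S'" if "subring S' R" "K \<union> insert s S \<subseteq> S'" for S'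
    proof (rule adjoin_subset[OF A(1) s that(1)])
      show "?A \<subseteq> S'" using that(2) by (intro A(3) that(1)) blast
      show "s \<in> S'" using that(2) by blast
    qed
  qed
  then show ?case
    using hilbert_basis_adjoin[OF A(1) s] insert.IH insert.prems by simp
qed

end

section \<open>Fields are Noetherian; maximal ideals in Noetherian rings\<close>

lemma (in field) field_imp_noetherian: "noetherian_ring R"
proof (rule noetherian_ringI)
  fix I assume "ideal I R"
  then have "I = Idl {\<zero>} \<or> I = Idl {\<one>}"
    using all_ideals genideal_zero genideal_one by auto
  then show "\<exists>A\<subseteq>carrier R. finite A \<and> I = Idl A"
  proof
    assume "I = Idl {\<zero>}"
    then show ?thesis by (intro exI[of _ "{\<zero>}"]) simp
  next
    assume "I = Idl {\<one>}"
    then show ?thesis by (intro exI[of _ "{\<one>}"]) simp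
  qed
qed

text \<open>Zorn's lemma with a cheap upper bound: in a Noetherian ring the union of a nonempty
  chain of ideals is a member of the chain, hence proper again. In the local case this puts a inside
  m.\<close>

lemma (in noetherian_ring) ex_maximalideal:
  assumes I: "ideal I R" "I \<noteq> carrier R"
  obtains M where "maximalideal M R" "I \<subseteq> M"
proof -
  let ?S = "{J. ideal J R \<and> J \<noteq> carrier R \<and> I \<subseteq> J}"
  have "\<exists>M\<in>?S. \<forall>J\<in>?S. M \<subseteq> J \<longrightarrow> J = M"
  proof (rule subset_Zorn)
    fix C assume C: "subset.chain ?S C"
    show "\<exists>U\<in>?S. \<forall>J\<in>C. J \<subseteq> U"
    proof (cases "C = {}")
      case True
      then show ?thesis using I by (intro bexI[of _ I]) simp_all
    next
      case False
      have "C \<subseteq> ?S" using C by (simp only: subset_chain_def)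
      moreover have "\<Union>C \<in> C"
      proof (rule ideal_chain_is_trivial[OF False])
        show "subset.chain {J. ideal J R} C"
          using C by (auto simp only: subset_chain_def)
      qed
      ultimately have "\<Union>C \<in> ?S" by (rule subsetD)
      then show ?thesis by (intro bexI[of _ "\<Union>C"] ballI Union_upper)
    qed
  qed
  then obtain M where M: "ideal M R" "M \<noteq> carrier R" "I \<subseteq> M"
    and max: "\<forall>J\<in>?S. M \<subseteq> J \<longrightarrow> J = M"
    by (elim bexE CollectE conjE)
  have "maximalideal M R"
  proof (rule maximalidealI)
    show "J = M \<or> J = carrier R" if "ideal J R" "M \<subseteq> J" "J \<subseteq> carrier R" for J
      using max that M(3) by (metis (mono_tags, lifting) mem_Collect_eq subset_trans)
  qed (use M in auto)
  then show thesis using M(3) by (rule that)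
qed

section \<open>Graded algebras: Noetherianity and the irrelevant ideal\<close>

context standard_graded_algebra
begin

lemma component_carrier: "x \<in> G n \<Longrightarrow> x \<in> carrier R"
  using additive_subgroup.a_subset[OF component_subgroup] by blast

lemma component_zero: "\<zero> \<in> G n"
  by (rule additive_subgroup.zero_closed[OF component_subgroup])

lemma noetherian: "noetherian_ring R"
proof -
  interpret K: field "R\<lparr>carrier := G 0\<rparr>"
    using subfield_iff(2)[OF base_field] .
  obtain S where S: "finite S" "S \<subseteq> G 1" "carrier R = generate_ring R (G 0 \<union> S)"
    using generated_in_degree_one by blast
  have "S \<subseteq> carrier R" using S(2) component_carrier by blast
  from noetherian_generate_ring[OF subfieldE(1)[OF base_field] K.field_imp_noetherian S(1) this]
  show ?thesis by (simp flip: S(3))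
qed

lemma component_subset_irrelevant_ideal:
  assumes "n \<ge> 1"
  shows "G n \<subseteq> irrelevant_ideal R G"
proof
  fix x assume x: "x \<in> G n"
  let ?f = "\<lambda>i. if i = n then x else \<zero>"
  have "(\<Oplus>i\<in>{1..n}. ?f i) = (\<Oplus>i\<in>{n}. ?f i)"
    using assms component_carrier[OF x] by (intro add.finprod_mono_neutral_cong_right) auto
  also have "\<dots> = x" using component_carrier[OF x] by simp
  finally have "x = (\<Oplus>i\<in>{1..n}. ?f i)" by (rule sym)
  moreover have "\<forall>i. ?f i \<in> G i" using x component_zero by simp
  ultimately show "x \<in> irrelevant_ideal R G"
    unfolding irrelevant_ideal_def by blast
qed

lemma irrelevant_ideal_add:
  assumes "x \<in> irrelevant_ideal R G" "y \<in> irrelevant_ideal R G"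
  shows "x \<oplus> y \<in> irrelevant_ideal R G"
proof -
  obtain f N g M where f: "\<forall>n. f n \<in> G n" "x = (\<Oplus>n\<in>{1..N}. f n)"
    and g: "\<forall>n. g n \<in> G n" "y = (\<Oplus>n\<in>{1..M}. g n)"
    using assms unfolding irrelevant_ideal_def by blast
  \<comment> \<open>The two sums may have different lengths; both are extended by zeros to the
    longer one and then added degree by degree.\<close>
  let ?pad = "\<lambda>f N n. if n \<le> N then f n else \<zero>"
  have pad: "(\<Oplus>n\<in>{1..K}. h n) = (\<Oplus>n\<in>{1..max N M}. ?pad h K n)"
    if "\<forall>n. h n \<in> G n" "K \<le> max N M" for h K
  proof (rule add.finprod_mono_neutral_cong_left)
    show "?pad h K \<in> {1..max N M} \<rightarrow> carrier R"
      using component_carrier[OF spec[OF that(1)]] by simp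
  qed (use that(2) in simp_all)
  have c: "?pad f N n \<in> G n" "?pad g M n \<in> G n" for n
    using f g component_zero by simp_all
  have "x \<oplus> y = (\<Oplus>n\<in>{1..max N M}. ?pad f N n \<oplus> ?pad g M n)"
    unfolding f(2) g(2) pad[OF f(1) max.cobounded1] pad[OF g(1) max.cobounded2]
    by (rule finsum_addf[symmetric]) (use c component_carrier in blast)+
  moreover have "\<forall>n. ?pad f N n \<oplus> ?pad g M n \<in> G n"
    using c additive_subgroup.a_closed[OF component_subgroup] by blast
  ultimately show ?thesis
    unfolding irrelevant_ideal_def by blast
qed

lemma irrelevant_ideal_zero: "\<zero> \<in> irrelevant_ideal R G"
  using component_subset_irrelevant_ideal[of 1] component_zero by auto

lemma irrelevant_ideal_carrier: "irrelevant_ideal R G \<subseteq> carrier R"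
  using component_carrier by (auto simp: irrelevant_ideal_def intro!: finsum_closed)

lemma irrelevant_ideal_finsum:
  assumes "finite S" "\<And>i. i \<in> S \<Longrightarrow> f i \<in> irrelevant_ideal R G"
  shows "(\<Oplus>i\<in>S. f i) \<in> irrelevant_ideal R G"
  using assms
proof (induction S)
  case empty
  then show ?case by (simp add: irrelevant_ideal_zero)
next
  case (insert i S)
  then have "(\<Oplus>i\<in>insert i S. f i) = f i \<oplus> (\<Oplus>i\<in>S. f i)"
    using irrelevant_ideal_carrier by (intro finsum_insert) auto
  then show ?case using insert irrelevant_ideal_add by simp
qed

text \<open>Split both factors into homogeneous components: a product of components of degrees n and
  i \<ge> 1 has positive degree n + i.\<close>

lemma irrelevant_ideal_ideal: "ideal (irrelevant_ideal R G) R"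
proof (rule ideal_cringI)
  fix r x assume r: "r \<in> carrier R" and x: "x \<in> irrelevant_ideal R G"
  obtain g where g: "\<forall>n. g n \<in> G n" "finite {n. g n \<noteq> \<zero>}" "r = (\<Oplus>n\<in>{n. g n \<noteq> \<zero>}. g n)"
    using decomposition[OF r] by blast
  obtain f N where f: "\<forall>n. f n \<in> G n" "x = (\<Oplus>n\<in>{1..N}. f n)"
    using x unfolding irrelevant_ideal_def by blast
  have gf: "g n \<otimes> x \<in> irrelevant_ideal R G" for n
  proof -
    have "g n \<otimes> x = (\<Oplus>i\<in>{1..N}. g n \<otimes> f i)"
      unfolding f(2) using f(1) g(1) component_carrier by (intro finsum_rdistr) auto
    also have "\<dots> \<in> irrelevant_ideal R G"
    proof (rule irrelevant_ideal_finsum)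
      fix i assume "i \<in> {1..N}"
      then have "G (n + i) \<subseteq> irrelevant_ideal R G"
        by (intro component_subset_irrelevant_ideal) auto
      then show "g n \<otimes> f i \<in> irrelevant_ideal R G"
        using component_mult f(1) g(1) by blast
    qed simp
    finally show ?thesis .
  qed
  have "r \<otimes> x = (\<Oplus>n\<in>{n. g n \<noteq> \<zero>}. g n \<otimes> x)"
    unfolding g(3) using g(1,2) component_carrier x irrelevant_ideal_carrier
    by (intro finsum_ldistr) auto
  then show "r \<otimes> x \<in> irrelevant_ideal R G"
    using irrelevant_ideal_finsum[OF g(2) gf] by simp
qed (use irrelevant_ideal_carrier irrelevant_ideal_zero irrelevant_ideal_add in auto)

text \<open>Homogeneous elements of the ideal generate it, so only these matter. One of degree 0
  must vanish, since a nonzero element of the field \<open>G 0\<close> is a unit and would make the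
  ideal improper.\<close>

lemma homogeneous_ideal_subset_irrelevant_ideal:
  assumes a: "homogeneous_ideal R G \<aa>" and proper: "\<aa> \<noteq> carrier R"
  shows "\<aa> \<subseteq> irrelevant_ideal R G"
proof -
  have aI: "ideal \<aa> R" and gen: "\<aa> = Idl (\<aa> \<inter> (\<Union>n. G n))"
    using a unfolding homogeneous_ideal_def by blast+
  have "x \<in> irrelevant_ideal R G" if x: "x \<in> \<aa>" "x \<in> G n" for x n
  proof (cases "n = 0")
    case True
    have "x = \<zero>"
    proof (rule ccontr)
      assume "x \<noteq> \<zero>"
      then have "inv x \<in> G 0" "x \<otimes> inv x = \<one>"
        using subfield_m_inv[OF base_field, of x] x True by auto
      then have "\<one> \<in> \<aa>"
        using ideal.I_r_closed[OF aI x(1)] component_carrier by metis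
      then show False using ideal.one_imp_carrier[OF aI] proper by blast
    qed
    then show ?thesis by (simp add: irrelevant_ideal_zero)
  next
    case False
    then show ?thesis using component_subset_irrelevant_ideal[of n] x by auto
  qed
  then show ?thesis
    by (subst gen) (intro genideal_minimal irrelevant_ideal_ideal, auto)
qed

end

section \<open>Ideal powers and Frobenius powers\<close>

context cring
begin

lemma binomial_expansion:
  assumes x: "x \<in> carrier R" and y: "y \<in> carrier R"
  shows "(x \<oplus> y) [^] n = (\<Oplus>k\<in>{..n}. [(n choose k)] \<cdot> (x [^] k \<otimes> y [^] (n - k)))"
proof (induction n)
  case 0
  show ?case using x y by simp
next
  case (Suc n)
  let ?t = "\<lambda>k. x [^] k \<otimes> y [^] (n - k)"
  let ?s = "\<lambda>k. x [^] k \<otimes> y [^] (Suc n - k)"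
  have t: "?t k \<in> carrier R" and s: "?s k \<in> carrier R" for k
    using x y by simp_all
  have "(x \<oplus> y) [^] Suc n = (\<Oplus>k\<in>{..n}. [(n choose k)] \<cdot> ?t k) \<otimes> x \<oplus> (\<Oplus>k\<in>{..n}. [(n choose k)] \<cdot> ?t k) \<otimes> y"
    using x y t by (simp add: Suc r_distr)
  also have "(\<Oplus>k\<in>{..n}. [(n choose k)] \<cdot> ?t k) \<otimes> x = (\<Oplus>k\<in>{..n}. [(n choose k)] \<cdot> ?s (Suc k))"
    using x y t 
    by (subst finsum_ldistr) (auto intro!: finsum_cong' simp: add_pow_ldistr add_pow_rdistr m_ac)
  also have "(\<Oplus>k\<in>{..n}. [(n choose k)] \<cdot> ?t k) \<otimes> y = (\<Oplus>k\<in>{..n}. [(n choose k)] \<cdot> ?s k)"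
    using x y t 
    by (subst finsum_ldistr) (auto intro!: finsum_cong' simp: add_pow_ldistr add_pow_rdistr Suc_diff_le m_ac)
  \<comment> \<open>The added top term vanishes because \<open>n choose Suc n\<close> is 0. With the
    bottom term split off next, both sums run over the same powers and Pascal's rule applies
    termwise.\<close>
  also have "\<dots> = (\<Oplus>k\<in>{..Suc n}. [(n choose k)] \<cdot> ?s k)"
    using s x y by (subst finsum_Suc) (simp_all add: binomial_eq_0)
  also have "\<dots> = (\<Oplus>k\<in>{..n}. [(n choose Suc k)] \<cdot> ?s (Suc k)) \<oplus> ?s 0"
    using s x y by (subst finsum_Suc2) simp_all
  also have "(\<Oplus>k\<in>{..n}. [(n choose k)] \<cdot> ?s (Suc k)) \<oplus> ((\<Oplus>k\<in>{..n}. [(n choose Suc k)] \<cdot> ?s (Suc k)) \<oplus> ?s 0)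
      = (\<Oplus>k\<in>{..n}. [(n choose k)] \<cdot> ?s (Suc k) \<oplus> [(n choose Suc k)] \<cdot> ?s (Suc k)) \<oplus> ?s 0"
    using s x y by (subst finsum_addf) (simp_all add: a_assoc Pi_def del: diff_Suc_Suc nat_pow_Suc)
  also have "\<dots> = (\<Oplus>k\<in>{..n}. [(Suc n choose Suc k)] \<cdot> ?s (Suc k)) \<oplus> ?s 0"
    using s x y by (simp add: add.nat_pow_mult del: diff_Suc_Suc nat_pow_Suc)
  also have "\<dots> = (\<Oplus>k\<in>{..Suc n}. [(Suc n choose k)] \<cdot> ?s k)"
    using s x y by (subst finsum_Suc2) simp_all
  finally show ?case .
qed

text \<open>The colon ideal (J : S). It turns the claim that certain products lie in J into an
  inclusion of ideals, which can be tested on generators.\<close>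

lemma colon_ideal:
  assumes J: "ideal J R" and S: "S \<subseteq> carrier R"
  shows "ideal {u \<in> carrier R. \<forall>s\<in>S. u \<otimes> s \<in> J} R"
proof -
  interpret J: ideal J R by fact
  show ?thesis
    using S by (intro ideal_cringI) (auto simp: subset_iff l_distr m_assoc J.I_l_closed)
qed

lemma genideal_subset_iff:
  assumes "ideal J R" "S \<subseteq> carrier R"
  shows "Idl S \<subseteq> J \<longleftrightarrow> S \<subseteq> J"
  using genideal_minimal[OF assms(1)] genideal_self[OF assms(2)] by blast

abbreviation ideal_pow :: "'a set \<Rightarrow> nat \<Rightarrow> 'a set" where
  "ideal_pow I t \<equiv> I [^]\<^bsub>ideals_set R\<^esub> t"

lemma ideals_set_simps [simp]:
  "\<one>\<^bsub>ideals_set R\<^esub> = carrier R"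
  "I \<otimes>\<^bsub>ideals_set R\<^esub> J = ideal_prod R I J"
  by (simp_all add: ideals_set_def)

lemma ideal_pow_0: "ideal_pow I 0 = carrier R"
  by simp

lemma ideal_pow_Suc: "ideal_pow I (Suc t) = ideal_prod R (ideal_pow I t) I"
  by simp

lemma ideal_pow_ideal: "ideal I R \<Longrightarrow> ideal (ideal_pow I t) R"
  by (induction t) (simp_all add: ideal_pow_0 ideal_pow_Suc oneideal ideal_prod_is_ideal)

lemma ideal_pow_antimono:
  assumes I: "ideal I R" and "s \<le> t"
  shows "ideal_pow I t \<subseteq> ideal_pow I s"
  using \<open>s \<le> t\<close>
proof (induction rule: dec_induct)
  case (step n)
  then show ?case
    using ideal_prod_inter[OF ideal_pow_ideal[OF I] I, of n] by (simp add: ideal_pow_Suc) blast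
qed simp

lemma mult_pow_mem_ideal_pow:
  assumes I: "ideal I R" and x: "x \<in> I" and y: "y \<in> ideal_pow I s"
  shows "x [^] n \<otimes> y \<in> ideal_pow I (n + s)"
proof (induction n)
  case 0
  then show ?case using y ideal.Icarr[OF ideal_pow_ideal[OF I] y] by simp
next
  case (Suc n)
  have c: "x \<in> carrier R" "y \<in> carrier R"
    using ideal.Icarr[OF I x] ideal.Icarr[OF ideal_pow_ideal[OF I] y] .
  have "(x [^] n \<otimes> y) \<otimes> x \<in> ideal_prod R (ideal_pow I (n + s)) I"
    using Suc x by (rule ideal_prod.prod)
  also have "(x [^] n \<otimes> y) \<otimes> x = x [^] Suc n \<otimes> y"
    using c by (simp add: m_ac)
  finally show ?case by (simp add: ideal_pow_Suc)
qed

lemma monomial_mem_ideal_pow: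
  assumes I: "ideal I R" and "finite B" "B \<subseteq> I"
  shows "(\<Otimes>b\<in>B. b [^] f b) \<in> ideal_pow I (sum f B)"
  using assms(2,3)
proof (induction B)
  case empty
  then show ?case by (simp add: ideal_pow_0)
next
  case (insert b B)
  then have "(\<Otimes>b\<in>insert b B. b [^] f b) = b [^] f b \<otimes> (\<Otimes>b\<in>B. b [^] f b)"
    using ideal.Icarr[OF I] by (subst finprod_insert) (auto simp: subset_iff)
  then show ?case
    using insert mult_pow_mem_ideal_pow[OF I, of b "\<Otimes>b\<in>B. b [^] f b" "sum f B" "f b"] by simp
qed

lemma finprod_nat_pow:
  assumes "f \<in> A \<rightarrow> carrier R"
  shows "(\<Otimes>a\<in>A. f a [^] (n :: nat)) = (\<Otimes>a\<in>A. f a) [^] n"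
proof (induction n)
  case (Suc n)
  have "(\<Otimes>a\<in>A. f a [^] n \<otimes> f a) = (\<Otimes>a\<in>A. f a [^] n) \<otimes> (\<Otimes>a\<in>A. f a)"
    using assms by (intro finprod_multf) auto
  then show ?case by (simp add: Suc)
qed simp

lemma monomial_mult:
  assumes "finite B" "B \<subseteq> carrier R" "b \<in> B"
  shows "(\<Otimes>c\<in>B. c [^] f c) \<otimes> b = (\<Otimes>c\<in>B. c [^] (f(b := Suc (f b))) c)"
proof -
  let ?g = "f(b := Suc (f b))"
  have B: "B = insert b (B - {b})" using assms(3) by auto
  have c: "b \<in> carrier R" "B - {b} \<subseteq> carrier R" using assms by auto
  have split: "(\<Otimes>c\<in>B. c [^] (h c :: nat)) = b [^] h b \<otimes> (\<Otimes>c\<in>B - {b}. c [^] h c)" for h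
    using assms c by (subst B, subst finprod_insert) (auto simp: subset_iff)
  have eq: "(\<Otimes>c\<in>B - {b}. c [^] ?g c) = (\<Otimes>c\<in>B - {b}. c [^] f c)"
    using c by (intro finprod_cong') (auto simp: subset_iff)
  have "(\<Otimes>c\<in>B - {b}. c [^] f c) \<in> carrier R"
    using c by (intro finprod_closed) (auto simp: subset_iff)
  then show ?thesis
    using c unfolding split eq by (simp add: m_ac)
qed

text \<open>Powers of an ideal are generated by the monomials in its generators. J varies in the
  induction because the hypothesis is applied to (J : B): a monomial of degree s lies there, as each
  further factor from B makes it a monomial of degree s + 1.\<close>

lemma ideal_pow_genideal_subset:
  assumes B: "finite B" "B \<subseteq> carrier R" and J: "ideal J R"
    and "\<And>f. sum f B = s \<Longrightarrow> (\<Otimes>b\<in>B. b [^] (f b :: nat)) \<in> J"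
  shows "ideal_pow (Idl B) s \<subseteq> J"
  using J assms(4)
proof (induction s arbitrary: J)
  case 0
  have "(\<Otimes>b\<in>B. b [^] (0::nat)) \<in> J" using 0(2)[of "\<lambda>_. 0"] by simp
  also have "(\<Otimes>b\<in>B. b [^] (0::nat)) = \<one>" by simp
  finally show ?case
    using ideal.one_imp_carrier[OF 0(1)] by (simp add: ideal_pow_0)
next
  case (Suc s)
  interpret J: ideal J R by fact
  let ?K = "{u \<in> carrier R. \<forall>b\<in>B. u \<otimes> b \<in> J}"
  have "ideal_pow (Idl B) s \<subseteq> ?K"
  proof (rule Suc.IH)
    fix f :: "'a \<Rightarrow> nat" assume f: "sum f B = s"
    have "(\<Otimes>c\<in>B. c [^] f c) \<otimes> b \<in> J" if b: "b \<in> B" for b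
    proof -
      have "sum (f(b := Suc (f b))) B = Suc s"
        using f b B(1) by (simp add: sum.remove[of B b])
      then show ?thesis
        using Suc.prems(2) monomial_mult[OF B b] by metis
    qed
    moreover have "(\<Otimes>c\<in>B. c [^] f c) \<in> carrier R"
      using B by (intro finprod_closed) (auto simp: subset_iff)
    ultimately show "(\<Otimes>c\<in>B. c [^] f c) \<in> ?K" by blast
  qed (rule colon_ideal[OF J.is_ideal B(2)])
  then have uB: "u \<in> carrier R" "\<forall>b\<in>B. b \<otimes> u \<in> J" if "u \<in> ideal_pow (Idl B) s" for u
    using that B(2) m_comm by (auto simp: subset_iff)
  have prod: "u \<otimes> v \<in> J" if u: "u \<in> ideal_pow (Idl B) s" and v: "v \<in> Idl B" for u v
  proof -
    have "Idl B \<subseteq> {v \<in> carrier R. \<forall>s\<in>{u}. v \<otimes> s \<in> J}"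
      using uB[OF u] B(2) by (intro genideal_minimal colon_ideal J.is_ideal) auto
    then show ?thesis
      using v uB(1)[OF u] m_comm by auto
  qed
  show ?case
  proof
    fix w assume "w \<in> ideal_pow (Idl B) (Suc s)"
    then show "w \<in> J" unfolding ideal_pow_Suc
      by (induction rule: ideal_prod.induct) (auto intro: prod)
  qed
qed

lemma frobenius_power_ideal: "J \<subseteq> carrier R \<Longrightarrow> ideal (frobenius_power R p J e) R"
  unfolding frobenius_power_def by (intro genideal_ideal) auto

lemma frobenius_power_subset_iff:
  assumes "J \<subseteq> carrier R" "ideal K R"
  shows "frobenius_power R p J e \<subseteq> K \<longleftrightarrow> (\<forall>x\<in>J. x [^] (p ^ e) \<in> K)"
proof -
  have "(\<lambda>x. x [^] (p ^ e)) ` J \<subseteq> carrier R" using assms by auto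
  from genideal_subset_iff[OF assms(2) this] show ?thesis
    unfolding frobenius_power_def by auto
qed

lemma frobenius_power_memI:
  assumes "J \<subseteq> carrier R" "x \<in> J"
  shows "x [^] (p ^ e) \<in> frobenius_power R p J e"
  using frobenius_power_subset_iff[OF assms(1) frobenius_power_ideal[OF assms(1)]] assms(2) by blast

text \<open>Pigeonhole: dividing the exponents of a monomial by \<open>p ^ e\<close> loses less than \<open>p ^ e\<close> per
  generator.\<close>

lemma ideal_pow_subset_frobenius_power:
  assumes B: "finite B" "B \<subseteq> carrier R" and p: "p > 0" and s: "p ^ e * (t + card B) \<le> s"
  shows "ideal_pow (Idl B) s \<subseteq> frobenius_power R p (ideal_pow (Idl B) t) e"
proof (rule ideal_pow_genideal_subset[OF B])
  let ?I = "Idl B" and ?q = "p ^ e"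
  have I: "ideal ?I R" using B by (intro genideal_ideal)
  have It: "ideal_pow ?I t \<subseteq> carrier R"
    using ideal.Icarr[OF ideal_pow_ideal[OF I]] by blast
  show J: "ideal (frobenius_power R p (ideal_pow ?I t) e) R"
    using It by (rule frobenius_power_ideal)
  fix f :: "'a \<Rightarrow> nat" assume f: "sum f B = s"
  \<comment> \<open>Dividing each exponent by \<open>?q\<close> with remainder writes the monomial
    as the \<open>?q\<close>-th power of \<open>?u\<close> times \<open>?v\<close>. As
    \<open>?u\<close> lies in the t-th power of \<open>?I\<close>, its \<open>?q\<close>-th power is
    a generator of the Frobenius power.\<close>
  let ?u = "\<Otimes>b\<in>B. b [^] (f b div ?q)" and ?v = "\<Otimes>b\<in>B. b [^] (f b mod ?q)"
  have "?q > 0" using p by simp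
  have "s \<le> (\<Sum>b\<in>B. ?q * (f b div ?q) + ?q)"
    unfolding f[symmetric]
  proof (rule sum_mono)
    fix b show "f b \<le> ?q * (f b div ?q) + ?q"
      using mod_less_divisor[OF \<open>?q > 0\<close>, of "f b"] mult_div_mod_eq[of ?q "f b"] by linarith
  qed
  also have "\<dots> = ?q * ((\<Sum>b\<in>B. f b div ?q) + card B)"
    by (simp add: sum.distrib sum_distrib_left distrib_left)
  finally have t: "t \<le> (\<Sum>b\<in>B. f b div ?q)"
    using s \<open>?q > 0\<close> by (meson add_le_cancel_right le_trans mult_le_cancel1)
  have u: "?u \<in> ideal_pow ?I t"
    using monomial_mem_ideal_pow[OF I B(1) genideal_self[OF B(2)]] ideal_pow_antimono[OF I t] by blast
  have c: "?u \<in> carrier R" "?v \<in> carrier R"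
    using B by (auto intro!: finprod_closed simp: subset_iff)
  have "(\<Otimes>b\<in>B. b [^] f b) = (\<Otimes>b\<in>B. (b [^] (f b div ?q)) [^] ?q \<otimes> b [^] (f b mod ?q))"
    using B(2) by (intro finprod_cong') (auto simp: subset_iff nat_pow_pow nat_pow_mult mult.commute[of _ ?q])
  also have "\<dots> = (\<Otimes>b\<in>B. (b [^] (f b div ?q)) [^] ?q) \<otimes> ?v"
    using B(2) by (intro finprod_multf) (auto simp: subset_iff)
  also have "(\<Otimes>b\<in>B. (b [^] (f b div ?q)) [^] ?q) = ?u [^] ?q"
    using B(2) by (intro finprod_nat_pow) (auto simp: subset_iff)
  finally show "(\<Otimes>b\<in>B. b [^] f b) \<in> frobenius_power R p (ideal_pow ?I t) e"
    using frobenius_power_memI[OF It u] ideal.I_r_closed[OF J] c by simp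
qed

text \<open>The exponents \<open>t\<close> with \<open>I\<^sup>t \<not>\<subseteq> J\<close> form an initial segment, so that \<open>Max\<close> determines them.\<close>

lemma not_ideal_pow_subset_iff:
  assumes I: "ideal I R" and J: "ideal J R" "J \<noteq> carrier R" and N: "ideal_pow I N \<subseteq> J"
  shows "\<not> ideal_pow I t \<subseteq> J \<longleftrightarrow> t \<le> Max {t. \<not> ideal_pow I t \<subseteq> J}"
proof -
  let ?T = "{t. \<not> ideal_pow I t \<subseteq> J}"
  \<comment> \<open>Properness of J enters here: the zeroth power is the whole ring, so
    \<open>Max\<close> is taken over a nonempty set.\<close>
  have "0 \<in> ?T"
    using J ideal.Icarr[OF J(1)] by (auto simp: ideal_pow_0)
  have down: "s \<in> ?T" if "t \<in> ?T" "s \<le> t" for s t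
    using that ideal_pow_antimono[OF I that(2)] by blast
  have "?T \<subseteq> {..<N}"
    using down[of _ N] N by (metis (mono_tags, lifting) lessThan_iff mem_Collect_eq not_less subsetI)
  then have "finite ?T" using finite_subset by blast
  then have "Max ?T \<in> ?T" using \<open>0 \<in> ?T\<close> Max_in[of ?T] by blast
  then show ?thesis
    using down[of "Max ?T" t] Max_ge[OF \<open>finite ?T\<close>, of t] by blast
qed

end

section \<open>Frobenius in prime characteristic\<close>

locale prime_char_cring = cring R for R (structure) +
  fixes p :: nat
  assumes prime_p: "Factorial_Ring.prime p" and ring_char_eq: "ring_char R = p"

context prime_char_cring
begin

lemma p_gt_1: "p > 1"
  using prime_p by (rule prime_gt_1_nat)

lemma add_pow_p_eq_zero:
  assumes "x \<in> carrier R"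
  shows "[p] \<cdot> x = \<zero>"
proof -
  have "[p] \<cdot> \<one> = \<zero>"
    using add.pow_ord_eq_1[of \<one>] ring_char_eq by (simp add: ring_char_def add_pow_def)
  moreover have "([p] \<cdot> \<one>) \<otimes> x = [p] \<cdot> x"
    using assms by (simp add: add_pow_ldistr)
  ultimately show ?thesis using assms by simp
qed

text \<open>p divides every binomial coefficient \<open>p choose k\<close> with 0 < k < p, so only
  the two outer terms of the expansion survive.\<close>

lemma frobenius_add_1:
  assumes x: "x \<in> carrier R" and y: "y \<in> carrier R"
  shows "(x \<oplus> y) [^] p = x [^] p \<oplus> y [^] p"
proof -
  let ?t = "\<lambda>k. [(p choose k)] \<cdot> (x [^] k \<otimes> y [^] (p - k))"
  have t: "?t k \<in> carrier R" for k using x y by simp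
  have mid: "?t k = \<zero>" if "0 < k" "k < p" for k
  proof -
    have "p dvd (p choose k)"
      using that prime_p by (intro dvd_choose_prime) auto
    then obtain c where c: "p choose k = p * c" by (rule dvdE)
    show ?thesis
      using x y unfolding c by (simp add: add_pow_p_eq_zero flip: add.nat_pow_pow)
  qed
  obtain n where n: "p = Suc n" using p_gt_1 by (cases p) auto
  have "(x \<oplus> y) [^] p = (\<Oplus>k\<in>{..p}. ?t k)"
    using x y by (rule binomial_expansion)
  also have "\<dots> = (\<Oplus>k\<in>{0, p}. ?t k)"
    using mid t by (intro add.finprod_mono_neutral_cong_right) (simp_all add: Pi_def)
  also have "\<dots> = x [^] p \<oplus> y [^] p"
    using x y p_gt_1 by (simp add: a_comm)
  finally show ?thesis .
qed

lemma frobenius_add: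
  assumes "x \<in> carrier R" "y \<in> carrier R"
  shows "(x \<oplus> y) [^] (p ^ e) = x [^] (p ^ e) \<oplus> y [^] (p ^ e)"
proof (induction e)
  case (Suc e)
  have "z [^] (p ^ Suc e) = (z [^] (p ^ e)) [^] p" if "z \<in> carrier R" for z
    using that by (simp add: nat_pow_pow mult.commute)
  then show ?case
    using assms by (simp add: Suc frobenius_add_1 del: power_Suc)
qed (use assms in simp)

text \<open>The preimage of an ideal under a ring endomorphism, the iterated Frobenius. It reduces
  claims about p^e-th powers of all elements of an ideal to its generators.\<close>

lemma frobenius_preimage_ideal:
  assumes J: "ideal J R"
  shows "ideal {x \<in> carrier R. x [^] (p ^ e) \<in> J} R"
proof -
  interpret J: ideal J R by fact
  have q: "p ^ e > 0" using p_gt_1 by simp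
  show ?thesis
    using q by (intro ideal_cringI) (auto simp: frobenius_add nat_pow_distrib nat_pow_zero J.I_l_closed)
qed

lemma frobenius_power_0:
  assumes "ideal J R"
  shows "frobenius_power R p J 0 = J"
proof -
  have "J \<subseteq> carrier R" using ideal.Icarr[OF assms] by blast
  then have "(\<lambda>x. x [^] (p ^ 0)) ` J = J" by (auto simp: subset_iff image_iff)
  moreover have "Idl J = J"
    using assms genideal_minimal[OF assms, of J] genideal_self[OF \<open>J \<subseteq> carrier R\<close>] by blast
  ultimately show ?thesis by (simp add: frobenius_power_def)
qed

text \<open>A general element of J^[p^e] is a combination of p^e-th powers and not itself such a
  power; the preimage under the k-th Frobenius reduces the claim to the generators.\<close>

lemma frobenius_power_add_subset:
  assumes J: "J \<subseteq> carrier R"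
  shows "frobenius_power R p (frobenius_power R p J e) k \<subseteq> frobenius_power R p J (e + k)"
proof -
  have F: "frobenius_power R p J e \<subseteq> carrier R"
    using ideal.Icarr[OF frobenius_power_ideal[OF J]] by blast
  have K: "ideal (frobenius_power R p J (e + k)) R" by (rule frobenius_power_ideal[OF J])
  have "frobenius_power R p J e \<subseteq> {x \<in> carrier R. x [^] (p ^ k) \<in> frobenius_power R p J (e + k)}"
    unfolding frobenius_power_subset_iff[OF J frobenius_preimage_ideal[OF K]]
    using J frobenius_power_memI[OF J, of _ p "e + k"]
    by (auto simp: subset_iff nat_pow_pow power_add)
  then show ?thesis
    unfolding frobenius_power_subset_iff[OF F K] by blast
qed

lemma frobenius_power_subset_self:
  assumes "ideal J R"
  shows "frobenius_power R p J e \<subseteq> J"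
proof -
  interpret J: ideal J R by fact
  have "x [^] (p ^ e) \<in> J" if "x \<in> J" for x
  proof -
    obtain n where "p ^ e = Suc n" using p_gt_1 by (cases "p ^ e") auto
    then show ?thesis using that by (simp add: J.I_l_closed)
  qed
  then show ?thesis
    using J.a_subset by (subst frobenius_power_subset_iff) (auto simp: J.is_ideal)
qed

lemma frobenius_power_mono:
  assumes "J \<subseteq> K" "K \<subseteq> carrier R"
  shows "frobenius_power R p J e \<subseteq> frobenius_power R p K e"
  using assms frobenius_power_memI[OF assms(2)] frobenius_power_ideal[OF assms(2)]
  by (subst frobenius_power_subset_iff) auto

end

section \<open>Splitting ideals and limits\<close>

context prime_char_cring
begin

lemma linear_maps_frobenius_iff:
  "\<psi> \<in> linear_maps R (frobenius_module R p e) (regular_module R) \<longleftrightarrow>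
     \<psi> \<in> carrier R \<rightarrow> carrier R \<and>
     (\<forall>x\<in>carrier R. \<forall>y\<in>carrier R. \<psi> (x \<oplus> y) = \<psi> x \<oplus> \<psi> y) \<and>
     (\<forall>r\<in>carrier R. \<forall>x\<in>carrier R. \<psi> (r [^] (p ^ e) \<otimes> x) = r \<otimes> \<psi> x)"
  by (simp add: linear_maps_def frobenius_module_def regular_module_def restrict_scalars_def)

text \<open>Multiplication by r is a linear endomorphism of F^e_* R, so precomposing with it sends
  test maps to test maps; this gives closure under multiplication.\<close>

lemma splitting_ideal_ideal:
  assumes m: "ideal \<mm> R"
  shows "ideal (splitting_ideal R \<mm> p e) R"
proof -
  interpret m: ideal \<mm> R by fact
  let ?L = "linear_maps R (frobenius_module R p e) (regular_module R)"
  let ?I = "splitting_ideal R \<mm> p e"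
  have mult: "r \<otimes> f \<in> ?I" if f: "f \<in> ?I" and r: "r \<in> carrier R" for r f
  proof -
    have "(\<lambda>x. \<psi> (r \<otimes> x)) \<in> ?L" if "\<psi> \<in> ?L" for \<psi>
      using that r by (auto simp: linear_maps_frobenius_iff r_distr m_lcomm[of r])
    then show ?thesis
      using f r by (auto simp: splitting_ideal_def)
  qed
  have zero: "\<zero> \<in> ?I"
  proof -
    have "\<psi> \<zero> \<in> \<mm>" if "\<psi> \<in> ?L" for \<psi>
    proof -
      have "\<psi> (\<zero> [^] (p ^ e) \<otimes> \<zero>) = \<zero> \<otimes> \<psi> \<zero>" "\<psi> \<zero> \<in> carrier R"
        using that unfolding linear_maps_frobenius_iff by blast+
      then show ?thesis by simp
    qed
    then show ?thesis by (simp add: splitting_ideal_def)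
  qed
  have add: "f \<oplus> g \<in> ?I" if "f \<in> ?I" "g \<in> ?I" for f g
    using that by (simp add: splitting_ideal_def linear_maps_frobenius_iff)
  show ?thesis
    using mult zero add by (intro ideal_cringI) (auto simp: splitting_ideal_def)
qed

lemma frobenius_power_splitting_ideal_subset:
  assumes m: "ideal \<mm> R"
  shows "frobenius_power R p (splitting_ideal R \<mm> p e) k \<subseteq> splitting_ideal R \<mm> p (e + k)"
proof -
  have "f [^] (p ^ k) \<in> splitting_ideal R \<mm> p (e + k)" if f: "f \<in> splitting_ideal R \<mm> p e" for f
  proof -
    \<comment> \<open>Additive because Frobenius is, and linear because the p^k-th power of r^(p^e)
      x is r^(p^(e+k)) x^(p^k), from which \<psi> extracts r.\<close>
    have "(\<lambda>x. \<psi> (x [^] (p ^ k))) \<in> linear_maps R (frobenius_module R p e) (regular_module R)"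
      if "\<psi> \<in> linear_maps R (frobenius_module R p (e + k)) (regular_module R)" for \<psi>
      using that
      by (auto simp: linear_maps_frobenius_iff frobenius_add nat_pow_distrib nat_pow_pow power_add)
    then show ?thesis
      using f by (auto simp: splitting_ideal_def)
  qed
  then show ?thesis
    using splitting_ideal_ideal[OF m]
    by (subst frobenius_power_subset_iff) (auto simp: splitting_ideal_def)
qed

text \<open>A linear map sends f^(p^e) = f^(p^e) 1 to f times its value at 1, hence into m. This
  provides an explicit power of a inside I_e, so that the maxima exist.\<close>

lemma frobenius_power_subset_splitting_ideal:
  assumes m: "ideal \<mm> R"
  shows "frobenius_power R p \<mm> e \<subseteq> splitting_ideal R \<mm> p e"
proof -
  interpret m: ideal \<mm> R by fact
  have "f [^] (p ^ e) \<in> splitting_ideal R \<mm> p e" if f: "f \<in> \<mm>" for f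
  proof -
    have "\<psi> (f [^] (p ^ e)) \<in> \<mm>"
      if "\<psi> \<in> linear_maps R (frobenius_module R p e) (regular_module R)" for \<psi>
    proof -
      have "\<psi> (f [^] (p ^ e) \<otimes> \<one>) = f \<otimes> \<psi> \<one>" "\<psi> \<one> \<in> carrier R"
        using that m.Icarr[OF f] unfolding linear_maps_frobenius_iff by blast+
      then show ?thesis using f m.Icarr[OF f] by (simp add: m.I_r_closed)
    qed
    then show ?thesis
      using m.Icarr[OF f] by (simp add: splitting_ideal_def)
  qed
  then show ?thesis
    using splitting_ideal_ideal[OF m] m.a_subset by (subst frobenius_power_subset_iff) auto
qed

end

text \<open>Adding \<open>2 C\<close> to the numerators makes the quotients decreasing.\<close>

lemma scaled_sequence_limit:
  fixes u :: "nat \<Rightarrow> nat" and p C :: nat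
  assumes p: "p > 1" and u: "\<And>e. u (Suc e) \<le> p * (u e + C)"
  obtains L where "(\<lambda>e. real (u e) / real (p ^ e)) \<longlonglongrightarrow> L"
    and "\<And>e. L \<le> real (u e + 2 * C) / real (p ^ e)"
proof -
  let ?w = "\<lambda>e. real (u e + 2 * C) / real (p ^ e)"
  have "?w (Suc e) \<le> ?w e" for e
  proof -
    \<comment> \<open>A correction D makes (u(e) + D) / p^e decrease as soon as p C + D \<le> p D; D
      = 2 C works for every p \<ge> 2.\<close>
    have "2 * C \<le> p * C" using p by simp
    moreover have "p * (u e + 2 * C) = p * (u e + C) + p * C" by (simp add: algebra_simps)
    ultimately have "u (Suc e) + 2 * C \<le> p * (u e + 2 * C)"
      using u[of e] by linarith
    then have "real (u (Suc e) + 2 * C) \<le> real p * real (u e + 2 * C)"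
      by (metis of_nat_le_iff of_nat_mult)
    then have "real (u (Suc e) + 2 * C) / real p \<le> real (u e + 2 * C)"
      using p by (simp add: pos_divide_le_eq mult.commute)
    then have "real (u (Suc e) + 2 * C) / real p / real (p ^ e) \<le> ?w e"
      by (intro divide_right_mono) simp_all
    then show ?thesis by simp
  qed
  then have "decseq ?w" by (rule decseq_SucI)
  then obtain L where L: "?w \<longlonglongrightarrow> L" "\<And>e. L \<le> ?w e"
    using decseq_convergent[of ?w 0] by (auto simp: divide_nonneg_nonneg)
  have "(\<lambda>e. real (2 * C) * (1 / real p) ^ e) \<longlonglongrightarrow> real (2 * C) * 0"
    using p by (intro tendsto_mult_left LIMSEQ_power_zero) simp
  then have "(\<lambda>e. ?w e - real (2 * C) * (1 / real p) ^ e) \<longlonglongrightarrow> L - 0"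
    using L(1) by (intro tendsto_diff) simp_all
  also have "(\<lambda>e. ?w e - real (2 * C) * (1 / real p) ^ e) = (\<lambda>e. real (u e) / real (p ^ e))"
    by (auto simp: power_one_over add_divide_distrib)
  finally show thesis using L(2) that by simp
qed

section \<open>F-thresholds of a finitely generated ideal and their comparison with fpt\<close>

context prime_char_cring
begin

context
  fixes B :: "'a set"
  assumes B: "finite B" "B \<subseteq> carrier R"
begin

text \<open>For a finitely generated ideal, lying in the radical of J means that some N-th power
  lies in J. Pigeonhole turns N into an exponent that works for J^[p^e], and J^[p^e] \<subseteq> J
  keeps the target proper.\<close>

lemma not_ideal_pow_subset_frobenius_power_iff:
  assumes J: "ideal J R" "J \<noteq> carrier R" and N: "ideal_pow (Idl B) N \<subseteq> J"
  shows "\<not> ideal_pow (Idl B) t \<subseteq> frobenius_power R p J e \<longleftrightarrow> t \<le> F_threshold_nu R p J (Idl B) e"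
  unfolding F_threshold_nu_def
proof (rule not_ideal_pow_subset_iff)
  have Jc: "J \<subseteq> carrier R" using ideal.Icarr[OF J(1)] by blast
  show "ideal (frobenius_power R p J e) R" by (rule frobenius_power_ideal[OF Jc])
  show "frobenius_power R p J e \<noteq> carrier R"
    using frobenius_power_subset_self[OF J(1)] Jc J(2) by blast
  have "ideal_pow (Idl B) (p ^ e * (N + card B)) \<subseteq> frobenius_power R p (ideal_pow (Idl B) N) e"
    using p_gt_1 by (intro ideal_pow_subset_frobenius_power B) auto
  also have "\<dots> \<subseteq> frobenius_power R p J e"
    using N Jc by (rule frobenius_power_mono)
  finally show "ideal_pow (Idl B) (p ^ e * (N + card B)) \<subseteq> frobenius_power R p J e" .
qed (rule genideal_ideal[OF B(2)])

lemma F_threshold_nu_Suc_le: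
  assumes J: "ideal J R" "J \<noteq> carrier R" and N: "ideal_pow (Idl B) N \<subseteq> J"
  shows "F_threshold_nu R p J (Idl B) (Suc e) \<le> p * (F_threshold_nu R p J (Idl B) e + Suc (card B))"
proof -
  let ?\<nu> = "F_threshold_nu R p J (Idl B)"
  note iff = not_ideal_pow_subset_frobenius_power_iff[OF J N]
  have Jc: "J \<subseteq> carrier R" using ideal.Icarr[OF J(1)] by blast
  have Fc: "frobenius_power R p J e \<subseteq> carrier R"
    using ideal.Icarr[OF frobenius_power_ideal[OF Jc]] by blast
  \<comment> \<open>The smallest exponent with containment in J^[p^e]; this is the 1 in card B +
    1.\<close>
  let ?t = "Suc (?\<nu> e)"
  have t: "ideal_pow (Idl B) ?t \<subseteq> frobenius_power R p J e"
    using iff[of ?t e] by simp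
  have "ideal_pow (Idl B) (p * (?t + card B)) \<subseteq> frobenius_power R p (ideal_pow (Idl B) ?t) 1"
    using p_gt_1 by (intro ideal_pow_subset_frobenius_power B) auto
  also have "\<dots> \<subseteq> frobenius_power R p (frobenius_power R p J e) 1"
    using t Fc by (rule frobenius_power_mono)
  also have "\<dots> \<subseteq> frobenius_power R p J (Suc e)"
    using frobenius_power_add_subset[OF Jc, of e 1] by simp
  finally show ?thesis
    using iff[of "p * (?t + card B)" "Suc e"] by simp
qed

text \<open>The bound is the decreasing estimate read off at e = 0, where J^[1] = J. For J = I_e it
  will compare the threshold with b(e).\<close>

lemma F_threshold_limit:
  assumes J: "ideal J R" "J \<noteq> carrier R" and N: "ideal_pow (Idl B) N \<subseteq> J"
  shows "(\<lambda>e. real (F_threshold_nu R p J (Idl B) e) / real (p ^ e)) \<longlonglongrightarrow> F_threshold R p J (Idl B)"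
    and "F_threshold R p J (Idl B) \<le> real (F_threshold_nu R p J (Idl B) 0 + 2 * Suc (card B))"
proof -
  obtain L where L: "(\<lambda>e. real (F_threshold_nu R p J (Idl B) e) / real (p ^ e)) \<longlonglongrightarrow> L"
    "\<And>e. L \<le> real (F_threshold_nu R p J (Idl B) e + 2 * Suc (card B)) / real (p ^ e)"
    by (rule scaled_sequence_limit[OF p_gt_1, of "F_threshold_nu R p J (Idl B)" "Suc (card B)",
          OF F_threshold_nu_Suc_le[OF J N]]) (rule that)
  have "F_threshold R p J (Idl B) = L"
    unfolding F_threshold_def using L(1) by (rule limI)
  then show "(\<lambda>e. real (F_threshold_nu R p J (Idl B) e) / real (p ^ e)) \<longlonglongrightarrow> F_threshold R p J (Idl B)"
    "F_threshold R p J (Idl B) \<le> real (F_threshold_nu R p J (Idl B) 0 + 2 * Suc (card B))"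
    using L(1) L(2)[of 0] by simp_all
qed

lemma fpt_eq_limit_of_proper:
  assumes m: "ideal \<mm> R" and a: "Idl B \<subseteq> \<mm>"
    and proper: "\<And>e. splitting_ideal R \<mm> p e \<noteq> carrier R"
  shows "(\<lambda>e. F_threshold R p (splitting_ideal R \<mm> p e) (Idl B) / real (p ^ e)) \<longlonglongrightarrow> fpt R \<mm> p (Idl B)"
proof -
  let ?I = "\<lambda>e. splitting_ideal R \<mm> p e" and ?a = "Idl B" and ?C = "Suc (card B)"
  let ?\<nu> = "\<lambda>e. F_threshold_nu R p (?I e) ?a" and ?b = "fpt_b R \<mm> p ?a"
  let ?c = "\<lambda>e. F_threshold R p (?I e) ?a"
  have I: "ideal (?I e) R" for e by (rule splitting_ideal_ideal[OF m])
  have mc: "\<mm> \<subseteq> carrier R" using ideal.Icarr[OF m] by blast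
  have aI: "ideal ?a R" using B by (intro genideal_ideal)
  \<comment> \<open>The first power unfolds to the product of R and a; the inclusion in a
    suffices.\<close>
  have "ideal_pow ?a 1 \<subseteq> \<mm>"
    using ideal_prod_inter[OF oneideal aI] a by auto
  have N: "ideal_pow ?a (p ^ e * (1 + card B)) \<subseteq> ?I e" for e
  proof -
    have "ideal_pow ?a (p ^ e * (1 + card B)) \<subseteq> frobenius_power R p (ideal_pow ?a 1) e"
      using p_gt_1 by (intro ideal_pow_subset_frobenius_power B) auto
    also have "\<dots> \<subseteq> frobenius_power R p \<mm> e"
      using \<open>ideal_pow ?a 1 \<subseteq> \<mm>\<close> mc by (rule frobenius_power_mono)
    also have "\<dots> \<subseteq> ?I e"
      by (rule frobenius_power_subset_splitting_ideal[OF m])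
    finally show ?thesis .
  qed
  have \<nu>: "\<not> ideal_pow ?a t \<subseteq> frobenius_power R p (?I e) k \<longleftrightarrow> t \<le> ?\<nu> e k" for t e k
    by (rule not_ideal_pow_subset_frobenius_power_iff[OF I proper N])
  \<comment> \<open>Since I_e^[1] = I_e, the number b(e) is the value of \<nu> for J = I_e at
    exponent 0, so facts about \<nu> carry over to b.\<close>
  have b0: "?b e = ?\<nu> e 0" for e
    by (simp add: fpt_b_def F_threshold_nu_def frobenius_power_0[OF I])
  have b: "\<not> ideal_pow ?a t \<subseteq> ?I e \<longleftrightarrow> t \<le> ?b e" for t e
    using \<nu>[of t e 0] by (simp add: b0 frobenius_power_0[OF I])
  have b_le: "?b (e + k) \<le> ?\<nu> e k" for e k
    using b[of "?b (e + k)" "e + k"] \<nu>[of "?b (e + k)" e k]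
      frobenius_power_splitting_ideal_subset[OF m, of e k] by auto
  \<comment> \<open>The ideal I_e changes with e, so the recurrence for a fixed J is used only for
    one step: from b(e) at exponent 0 to exponent 1, which bounds b(e + 1).\<close>
  have "?b (Suc e) \<le> p * (?b e + ?C)" for e
  proof -
    have "?b (Suc e) \<le> ?\<nu> e (Suc 0)" using b_le[of e 1] by simp
    also have "\<dots> \<le> p * (?\<nu> e 0 + ?C)" by (rule F_threshold_nu_Suc_le[OF I proper N])
    finally show ?thesis unfolding b0 .
  qed
  then obtain L where L: "(\<lambda>e. real (?b e) / real (p ^ e)) \<longlonglongrightarrow> L"
    by (rule scaled_sequence_limit[OF p_gt_1, of ?b ?C]) (rule that)
  then have fpt: "fpt R \<mm> p ?a = L"
    unfolding fpt_def by (rule limI)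
  \<comment> \<open>With e fixed and k growing, the left-hand sides run through a tail of the
    sequence for fpt; on the right, p^(k+e) = p^k p^e splits off the factor that stays
    fixed.\<close>
  have lower: "L \<le> ?c e / real (p ^ e)" for e
  proof (rule LIMSEQ_le)
    show "(\<lambda>k. real (?b (k + e)) / real (p ^ (k + e))) \<longlonglongrightarrow> L"
      using L by (rule LIMSEQ_ignore_initial_segment)
    show "(\<lambda>k. real (?\<nu> e k) / real (p ^ k) / real (p ^ e)) \<longlonglongrightarrow> ?c e / real (p ^ e)"
      using p_gt_1 by (intro tendsto_divide F_threshold_limit(1)[OF I proper N] tendsto_const) simp
    show "\<exists>N. \<forall>k\<ge>N. real (?b (k + e)) / real (p ^ (k + e)) \<le> real (?\<nu> e k) / real (p ^ k) / real (p ^ e)"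
    proof (intro exI allI impI)
      fix k
      have "real (?b (k + e)) / real (p ^ k) / real (p ^ e) \<le> real (?\<nu> e k) / real (p ^ k) / real (p ^ e)"
        using b_le[of e k] by (intro divide_right_mono) (simp_all add: add.commute[of k e])
      then show "real (?b (k + e)) / real (p ^ (k + e)) \<le> real (?\<nu> e k) / real (p ^ k) / real (p ^ e)"
        by (simp add: power_add)
    qed
  qed
  have upper: "?c e / real (p ^ e) \<le> real (?b e) / real (p ^ e) + real (2 * ?C) * (1 / real p) ^ e" for e
  proof -
    have "?c e / real (p ^ e) \<le> real (?b e + 2 * ?C) / real (p ^ e)"
      using F_threshold_limit(2)[OF I[of e] proper N] unfolding b0 by (intro divide_right_mono) simp_all
    also have "\<dots> = real (?b e) / real (p ^ e) + real (2 * ?C) * (1 / real p) ^ e"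
      by (simp only: power_one_over add_divide_distrib of_nat_add of_nat_power times_divide_eq_right mult_1_right)
    finally show ?thesis .
  qed
  have "(\<lambda>e. real (?b e) / real (p ^ e) + real (2 * ?C) * (1 / real p) ^ e) \<longlonglongrightarrow> L + real (2 * ?C) * 0"
    using p_gt_1 by (intro tendsto_add L tendsto_mult_left LIMSEQ_power_zero) simp
  then have "(\<lambda>e. real (?b e) / real (p ^ e) + real (2 * ?C) * (1 / real p) ^ e) \<longlonglongrightarrow> L"
    by (simp only: mult_zero_right add_0_right)
  from tendsto_sandwich[OF always_eventually always_eventually tendsto_const this] show ?thesis
    unfolding fpt by this (intro allI lower upper)+
qed

end

text \<open>Once some \<open>I\<^sub>e\<close> is improper, all later ones are, and then every maximum involved is the
  junk value \<open>Max {}\<close>, so that both sides vanish.\<close>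

lemma fpt_eq_limit_of_improper:
  assumes m: "ideal \<mm> R" and a: "ideal \<aa> R"
    and improper: "splitting_ideal R \<mm> p e = carrier R"
  shows "(\<lambda>e. F_threshold R p (splitting_ideal R \<mm> p e) \<aa> / real (p ^ e)) \<longlonglongrightarrow> fpt R \<mm> p \<aa>"
proof -
  \<comment> \<open>The value of \<open>Max {}\<close> is unknown, but it is one fixed natural
    number for all exponents, so division by p^e makes it vanish in the limit.\<close>
  have to0: "(\<lambda>e. real c / real (p ^ e)) \<longlonglongrightarrow> 0" for c
  proof -
    have "(\<lambda>e. real c * (1 / real p) ^ e) \<longlonglongrightarrow> real c * 0"
      using p_gt_1 by (intro tendsto_mult_left LIMSEQ_power_zero) simp
    then show ?thesis by (simp add: power_one_over)
  qed
  have pow: "ideal_pow \<aa> t \<subseteq> carrier R" for t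
    using ideal.Icarr[OF ideal_pow_ideal[OF a]] by blast
  have one: "frobenius_power R p (carrier R) k = carrier R" for k
    using frobenius_power_memI[OF order_refl one_closed, of p k]
      ideal.one_imp_carrier[OF frobenius_power_ideal[OF order_refl]] by simp
  \<comment> \<open>I_k contains the Frobenius power of I_e of exponent k - e, and every Frobenius
    power of the unit ideal is the unit ideal.\<close>
  have I: "splitting_ideal R \<mm> p k = carrier R" if "k \<ge> e" for k
    using frobenius_power_splitting_ideal_subset[OF m, of e "k - e"] that improper one
    by (auto simp: splitting_ideal_def)
  have b: "fpt_b R \<mm> p \<aa> k = Max {}" if "k \<ge> e" for k
    using pow by (simp add: fpt_b_def I[OF that])
  have "\<forall>\<^sub>F k in sequentially. real (Max {}) / real (p ^ k) = real (fpt_b R \<mm> p \<aa> k) / real (p ^ k)"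
    using eventually_ge_at_top[of e] by eventually_elim (simp add: b)
  with to0[of "Max {}"] have "(\<lambda>k. real (fpt_b R \<mm> p \<aa> k) / real (p ^ k)) \<longlonglongrightarrow> 0"
    by (rule Lim_transform_eventually)
  then have fpt: "fpt R \<mm> p \<aa> = 0"
    unfolding fpt_def by (rule limI)
  have "F_threshold R p (splitting_ideal R \<mm> p k) \<aa> = 0" if "k \<ge> e" for k
    unfolding F_threshold_def
    using pow by (intro limI) (simp add: F_threshold_nu_def I[OF that] one to0[simplified])
  then show ?thesis
    unfolding fpt by (intro tendsto_eventually) (auto simp: eventually_sequentially)
qed

theorem fpt_eq_limit_of_F_thresholds:
  assumes m: "ideal \<mm> R" and B: "finite B" "B \<subseteq> carrier R" and a: "Idl B \<subseteq> \<mm>"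
  shows "(\<lambda>e. F_threshold R p (splitting_ideal R \<mm> p e) (Idl B) / real (p ^ e)) \<longlonglongrightarrow> fpt R \<mm> p (Idl B)"
  using fpt_eq_limit_of_proper[OF B m a] fpt_eq_limit_of_improper[OF m genideal_ideal[OF B(2)]] by blast

end

section \<open>Graded and local rings together\<close>

theorem theorem4p6:
  fixes R :: "('a, 'b) ring_scheme" and \<mm> \<aa> :: "'a set" and p :: nat
  assumes "(\<exists>G. standard_graded_algebra R G \<and> \<mm> = irrelevant_ideal R G \<and> homogeneous_ideal R G \<aa>) \<or>
           (noetherian_local_ring R \<mm> \<and> ideal \<aa> R)"
    and "Factorial_Ring.prime p" and "ring_char R = p"
    and "F_finite R p" and "F_pure R p"
    and "\<aa> \<noteq> carrier R"
  shows "(\<lambda>e. F_threshold R p (splitting_ideal R \<mm> p e) \<aa> / real (p ^ e)) \<longlonglongrightarrow> fpt R \<mm> p \<aa>"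
proof -
  have "cring R \<and> noetherian_ring R \<and> ideal \<mm> R \<and> ideal \<aa> R \<and> \<aa> \<subseteq> \<mm>"
    using assms(1)
  proof (elim disjE exE conjE)
    fix G assume G: "standard_graded_algebra R G" "\<mm> = irrelevant_ideal R G" "homogeneous_ideal R G \<aa>"
    interpret standard_graded_algebra R G by fact
    show ?thesis
      using noetherian irrelevant_ideal_ideal homogeneous_ideal_subset_irrelevant_ideal[OF G(3) assms(6)]
        G(2,3) cring_axioms by (simp add: homogeneous_ideal_def)
  next
    assume local: "noetherian_local_ring R \<mm>" and a: "ideal \<aa> R"
    interpret noetherian_local_ring R \<mm> by fact
    \<comment> \<open>A proper ideal lies in some maximal ideal, which uniqueness identifies with
      m.\<close>
    obtain M where "maximalideal M R" "\<aa> \<subseteq> M"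
      using ex_maximalideal[OF a assms(6)] .
    then show ?thesis
      using a unique_maximal cring_axioms noetherian_ring_axioms maximalideal.axioms(1)[OF maximal] by simp
  qed
  then have "cring R" "noetherian_ring R" and m: "ideal \<mm> R" and a: "ideal \<aa> R" "\<aa> \<subseteq> \<mm>"
    by simp_all
  interpret noetherian_ring R by fact
  interpret prime_char_cring R p
    using \<open>cring R\<close> assms(2,3) by (simp add: prime_char_cring_def prime_char_cring_axioms_def)
  obtain B where B: "B \<subseteq> carrier R" "finite B" "\<aa> = Idl\<^bsub>R\<^esub> B"
    using finetely_gen[OF a(1)] by blast
  show ?thesis
    using fpt_eq_limit_of_F_thresholds[OF m B(2,1)] a(2) unfolding B(3) .
qed

end
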